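(* Let $n\ge3$ and let $S_n$ act on $V=W^*\oplus W\cong\mathbb{C}^{2n}$ by the doubled permutation representation. The maps $\kappa=\kappa^L+\kappa^C$ with linear part $\kappa^L=\kappa^L_1+\kappa^L_{\mathrm{ref}}$ and constant part $\kappa^C=\kappa^C_1+\kappa^C_{\mathrm{ref}}+\kappa^C_{\mathrm{3\text{-}cyc}}$ (defined in the context in terms of complex parameters) whose parameters satisfy the following are Drinfeld orbifold algebra maps: (1) $a_i=b_i=0$ for $i=1,2,3,5,6$, and $a_4=a_7$ and $b_4=b_7$ are not both zero; (2) $\alpha=\beta$; (3) $2a+(n-2)a^\perp=2b+(n-2)b^\perp=0$, but $a,a^\perp,b,b^\perp$ are not all zero.
   Context: Let $G$ be a finite group acting linearly on a finite-dimensional complex vector space $V$; write ${}^{g}v$ for the action and $V^g$ for the fixed space of $g$. A 2-cochain is $\kappa=\sum_{g\in G}\kappa_g g$ with linear components $\kappa_g:\bigwedge^2V\to S(V)$ (skew-symmetric bilinear maps); it is linear if every $\kappa_g$ maps into $V$, constant if every $\kappa_g$ maps into $\mathbb{C}$. It is $G$-invariant if ${}^{h}(\kappa_g(u,v))=\kappa_{hgh^{-1}}({}^{h}u,{}^{h}v)$ for all $g,h,u,v$. For linear $\kappa^L$ and constant $\kappa^C$, $\kappa=\kappa^L+\kappa^C$ is a Drinfeld orbifold algebra map if for all $g\in G$, $v_1,v_2,v_3\in V$ ($\mathrm{Alt}_3$ the alternating group on three letters): (0) $\mathrm{im}\,\kappa^L_g\subseteq V^g$; (i) $\kappa^L,\kappa^C$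 are $G$-invariant; (ii) $\sum_{\sigma\in\mathrm{Alt}_3}\kappa^L_g(v_{\sigma(2)},v_{\sigma(3)})({}^{g}v_{\sigma(1)}-v_{\sigma(1)})=0$ in $S(V)$; (iii) $\sum_{\sigma\in\mathrm{Alt}_3}\sum_{xy=g}\kappa^L_x\big(v_{\sigma(1)}+{}^{y}v_{\sigma(1)},\kappa^L_y(v_{\sigma(2)},v_{\sigma(3)})\big)=2\sum_{\sigma\in\mathrm{Alt}_3}\kappa^C_g(v_{\sigma(2)},v_{\sigma(3)})({}^{g}v_{\sigma(1)}-v_{\sigma(1)})$; (iv) $\sum_{\sigma\in\mathrm{Alt}_3}\sum_{xy=g}\kappa^C_x\big(v_{\sigma(1)}+{}^{y}v_{\sigma(1)},\kappa^L_y(v_{\sigma(2)},v_{\sigma(3)})\big)=0$. $W\cong\mathbb{C}^n$ has basis $y_1,\dots,y_n$, $W^*$ has dual basis $x_1,\dots,x_n$, and ${}^{\sigma}y_i=y_{\sigma(i)}$, ${}^{\sigma}x_i=x_{\sigma(i)}$. For $v=x$ or $y$ let $v_{[n]}=\sum_i v_i$, $v_{r,s}=v_r+v_s$, $v_{r,s}^\perp=v_{[n]}-v_{r,s}$. The maps below depend on complex parameters $a_1,\dots,a_7,b_1,\dots,b_7,\alpha,\beta,a,a^\perp,b,b^\perp,c$ ($1\le i\neq j\le n$ unless stated). $\kappa^L_1$ (supported on the identity): $\kappa^L_1(x_i,x_j)=a_1(x_i-x_j)+b_1(y_i-y_j)$; $\kappa^L_1(y_i,y_j)=a_2(x_i-x_j)+b_2(y_i-y_j)$;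 $\kappa^L_1(x_i,y_i)=a_3x_i+a_4x_{[n]}+b_3y_i+b_4y_{[n]}$; $\kappa^L_1(x_i,y_j)=a_5x_i+a_6x_j+a_7x_{[n]}+b_5y_i+b_6y_j+b_7y_{[n]}$. $\kappa^C_1$ (supported on the identity): $\kappa^C_1(x_i,x_j)=\kappa^C_1(y_i,y_j)=0$, $\kappa^C_1(x_i,y_i)=\alpha$, $\kappa^C_1(x_i,y_j)=\beta$. $\kappa^L_{\mathrm{ref}}$, $\kappa^C_{\mathrm{ref}}$ (supported on transpositions $g=(rs)$): for all $i,j$, $\kappa^*_g(x_i,x_j)=\kappa^*_g(y_i,y_j)=0$ for $*=L,C$. Put $u_g=ax_{r,s}+a^\perp x_{r,s}^\perp+by_{r,s}+b^\perp y_{r,s}^\perp$. Then $\kappa^L_g(x_i,y_j)$ is $u_g$ if $i=j\in\{r,s\}$, $-u_g$ if $\{i,j\}=\{r,s\}$, and $0$ otherwise; $\kappa^C_g(x_i,y_j)$ is respectively $c$, $-c$, $0$. $\kappa^C_{\mathrm{3\text{-}cyc}}$ (supported on 3-cycles): for $g=(i\,j\,k)$, $\kappa^C_g$ is zero on a pair of basis vectors unless their indices are two distinct elements of $\{i,j,k\}$, and $\kappa^C_g(x_i,x_j)=\kappa^C_g(x_j,x_k)=\kappa^C_g(x_k,x_i)=(b^\perp-b)^2$; $\kappa^C_g(y_i,y_j)=\kappa^C_g(y_j,y_k)=\kappa^C_g(y_k,y_i)=(a^\perp-a)^2$; $\kappa^C_g(x_i,y_j)=\kappa^C_g(y_j,x_k)=\kappa^C_g(x_k,y_i)=\kappa^C_g(y_i,x_j)=\kappa^C_g(x_j,y_k)=\kappa^C_g(y_k,x_i)=-(a^\perp-a)(b^\perp-b)$.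 *)

theory Defs
  imports
    "HOL-Analysis.Analysis"
    "HOL-Algebra.Algebra"
    "HOL-Combinatorics.Combinatorics"
    "HOL-Library.Poly_Mapping"
begin

section \<open>Drinfeld orbifold algebra maps\<close>

text \<open>
  A finite-dimensional complex vector space is taken in coordinates, as \<open>complex^'m\<close>; its
  symmetric algebra is then the polynomial ring in commuting variables indexed by \<open>'m\<close>
  (finitely supported functions from exponent vectors to coefficients, with the convolution
  product), and \<open>sym_of_vec\<close> is the inclusion of \<open>V\<close> as the degree-one part of \<open>S(V)\<close>.
\<close>

type_synonym 'm sym_alg = "('m \<Rightarrow>\<^sub>0 nat) \<Rightarrow>\<^sub>0 complex"

definition sym_of_vec :: "complex^'m \<Rightarrow> 'm::finite sym_alg" where
  "sym_of_vec v = (\<Sum>i\<in>UNIV. Poly_Mapping.single (Poly_Mapping.single i 1) (v $ i))"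

definition linear_group_action ::
    "'g monoid \<Rightarrow> ('g \<Rightarrow> complex^'m \<Rightarrow> complex^'m::finite) \<Rightarrow> bool" where
  "linear_group_action G act \<longleftrightarrow>
     finite (carrier G) \<and> group_action G UNIV act \<and>
     (\<forall>g\<in>carrier G. Vector_Spaces.linear vector_scalar_mult vector_scalar_mult (act g))"

text \<open>
  Skew-symmetric bilinear maps, that is, linear maps on the exterior square, into a complex
  vector space with scalar multiplication \<open>smul\<close>.
\<close>

definition skew_bilinear ::
    "(complex \<Rightarrow> 'b \<Rightarrow> 'b) \<Rightarrow> (complex^'m \<Rightarrow> complex^'m::finite \<Rightarrow> 'b::ab_group_add) \<Rightarrow> bool" where
  "skew_bilinear smul f \<longleftrightarrow>
     (\<forall>u. Vector_Spaces.linear vector_scalar_mult smul (\<lambda>v. f u v)) \<and>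
     (\<forall>v. Vector_Spaces.linear vector_scalar_mult smul (\<lambda>u. f u v)) \<and>
     (\<forall>u v. f u v = - f v u)"

text \<open>
  A cochain \<open>\<kappa> = \<kappa>\<^sup>L + \<kappa>\<^sup>C\<close> with a linear and a constant part is given by its two homogeneous
  parts, the linear one with values in \<open>V\<close> and the constant one with values in the scalars.
\<close>

definition drinfeld_orbifold_algebra_map ::
    "'g monoid \<Rightarrow> ('g \<Rightarrow> complex^'m \<Rightarrow> complex^'m)
      \<Rightarrow> ('g \<Rightarrow> complex^'m \<Rightarrow> complex^'m \<Rightarrow> complex^'m)
      \<Rightarrow> ('g \<Rightarrow> complex^'m \<Rightarrow> complex^'m \<Rightarrow> complex) \<Rightarrow> bool" where
  "drinfeld_orbifold_algebra_map G act \<kappa>L \<kappa>C \<longleftrightarrow>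
     linear_group_action G act \<and>
     (\<forall>g\<in>carrier G. skew_bilinear vector_scalar_mult (\<kappa>L g)) \<and>
     (\<forall>g\<in>carrier G. skew_bilinear times (\<kappa>C g)) \<and>
     \<comment> \<open>(0)\<close>
     (\<forall>g\<in>carrier G. \<forall>u v. act g (\<kappa>L g u v) = \<kappa>L g u v) \<and>
     \<comment> \<open>(i)\<close>
     (\<forall>g\<in>carrier G. \<forall>h\<in>carrier G. \<forall>u v.
        act h (\<kappa>L g u v) = \<kappa>L (h \<otimes>\<^bsub>G\<^esub> g \<otimes>\<^bsub>G\<^esub> inv\<^bsub>G\<^esub> h) (act h u) (act h v)) \<and>
     (\<forall>g\<in>carrier G. \<forall>h\<in>carrier G. \<forall>u v.
        \<kappa>C g u v = \<kappa>C (h \<otimes>\<^bsub>G\<^esub> g \<otimes>\<^bsub>G\<^esub> inv\<^bsub>G\<^esub> h) (act h u) (act h v)) \<and>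
     \<comment> \<open>(ii)\<close>
     (\<forall>g\<in>carrier G. \<forall>v :: nat \<Rightarrow> complex^'m.
        (\<Sum>\<sigma>\<in>carrier (alt_group 3).
           sym_of_vec (\<kappa>L g (v (\<sigma> 2)) (v (\<sigma> 3))) * sym_of_vec (act g (v (\<sigma> 1)) - v (\<sigma> 1))) = 0) \<and>
     \<comment> \<open>(iii)\<close>
     (\<forall>g\<in>carrier G. \<forall>v :: nat \<Rightarrow> complex^'m.
        (\<Sum>\<sigma>\<in>carrier (alt_group 3).
           \<Sum>(x, y)\<in>{(x, y). x \<in> carrier G \<and> y \<in> carrier G \<and> x \<otimes>\<^bsub>G\<^esub> y = g}.
             \<kappa>L x (v (\<sigma> 1) + act y (v (\<sigma> 1))) (\<kappa>L y (v (\<sigma> 2)) (v (\<sigma> 3)))) =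
        2 *s (\<Sum>\<sigma>\<in>carrier (alt_group 3).
           \<kappa>C g (v (\<sigma> 2)) (v (\<sigma> 3)) *s (act g (v (\<sigma> 1)) - v (\<sigma> 1)))) \<and>
     \<comment> \<open>(iv)\<close>
     (\<forall>g\<in>carrier G. \<forall>v :: nat \<Rightarrow> complex^'m.
        (\<Sum>\<sigma>\<in>carrier (alt_group 3).
           \<Sum>(x, y)\<in>{(x, y). x \<in> carrier G \<and> y \<in> carrier G \<and> x \<otimes>\<^bsub>G\<^esub> y = g}.
             \<kappa>C x (v (\<sigma> 1) + act y (v (\<sigma> 1))) (\<kappa>L y (v (\<sigma> 2)) (v (\<sigma> 3)))) = 0)"

section \<open>The doubled permutation representation\<close>

text \<open>
  The indices \<open>1, ..., n\<close> are the elements of a finite type \<open>'n\<close> with \<open>n = CARD('n)\<close>, and the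
  symmetric group is \<open>BijGroup (UNIV :: 'n set)\<close>, with composition from right to left.  The space
  \<open>V = W\<^sup>* \<oplus> W\<close> is \<open>complex^('n + 'n)\<close>: the left summand of the index type carries the
  coordinates of \<open>W\<^sup>*\<close> and the right one those of \<open>W\<close>.
\<close>

type_synonym 'n dbl = "complex^('n + 'n)"

definition xvec :: "'n \<Rightarrow> 'n::finite dbl" where
  "xvec i = axis (Inl i) 1"

definition yvec :: "'n \<Rightarrow> 'n::finite dbl" where
  "yvec i = axis (Inr i) 1"

definition doubled_perm_action :: "('n \<Rightarrow> 'n) \<Rightarrow> 'n dbl \<Rightarrow> 'n::finite dbl" where
  "doubled_perm_action \<sigma> v =
     (\<Sum>i\<in>UNIV. (v $ Inl i) *s xvec (\<sigma> i)) + (\<Sum>i\<in>UNIV. (v $ Inr i) *s yvec (\<sigma> i))"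

text \<open>
  The bilinear map whose values on \<open>(x\<^sub>i, x\<^sub>j)\<close>, \<open>(x\<^sub>i, y\<^sub>j)\<close>, \<open>(y\<^sub>i, y\<^sub>j)\<close> are \<open>xx i j\<close>, \<open>xy i j\<close>,
  \<open>yy i j\<close>, and whose value on \<open>(y\<^sub>i, x\<^sub>j)\<close> is \<open>- xy j i\<close>.  It is skew-symmetric when \<open>xx\<close> and
  \<open>yy\<close> are.
\<close>

fun skew_table ::
    "('n \<Rightarrow> 'n \<Rightarrow> 'b) \<Rightarrow> ('n \<Rightarrow> 'n \<Rightarrow> 'b) \<Rightarrow> ('n \<Rightarrow> 'n \<Rightarrow> 'b)
      \<Rightarrow> 'n + 'n \<Rightarrow> 'n + 'n \<Rightarrow> 'b::ab_group_add" where
  "skew_table xx xy yy (Inl i) (Inl j) = xx i j"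
| "skew_table xx xy yy (Inl i) (Inr j) = xy i j"
| "skew_table xx xy yy (Inr i) (Inl j) = - xy j i"
| "skew_table xx xy yy (Inr i) (Inr j) = yy i j"

definition bilinear_of_table ::
    "(complex \<Rightarrow> 'b \<Rightarrow> 'b) \<Rightarrow> ('n \<Rightarrow> 'n \<Rightarrow> 'b) \<Rightarrow> ('n \<Rightarrow> 'n \<Rightarrow> 'b) \<Rightarrow> ('n \<Rightarrow> 'n \<Rightarrow> 'b)
      \<Rightarrow> 'n::finite dbl \<Rightarrow> 'n dbl \<Rightarrow> 'b::ab_group_add" where
  "bilinear_of_table smul xx xy yy u v =
     (\<Sum>p\<in>UNIV. \<Sum>q\<in>UNIV. smul (u $ p * v $ q) (skew_table xx xy yy p q))"

section \<open>The component maps\<close>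

text \<open>
  The parameters \<open>a\<^sub>1, ..., a\<^sub>7\<close> and \<open>b\<^sub>1, ..., b\<^sub>7\<close> are the values of functions \<open>aa\<close>, \<open>bb\<close> at
  \<open>1, ..., 7\<close>; other values of these functions are not used.
\<close>

definition \<kappa>L_one ::
    "(nat \<Rightarrow> complex) \<Rightarrow> (nat \<Rightarrow> complex) \<Rightarrow> ('n \<Rightarrow> 'n)
      \<Rightarrow> 'n::finite dbl \<Rightarrow> 'n dbl \<Rightarrow> 'n dbl" where
  "\<kappa>L_one aa bb g =
     (if g = id then
        bilinear_of_table vector_scalar_mult
          (\<lambda>i j. aa 1 *s (xvec i - xvec j) + bb 1 *s (yvec i - yvec j))
          (\<lambda>i j. if i = j
             then aa 3 *s xvec i + aa 4 *s (\<Sum>k\<in>UNIV. xvec k)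
                + bb 3 *s yvec i + bb 4 *s (\<Sum>k\<in>UNIV. yvec k)
             else aa 5 *s xvec i + aa 6 *s xvec j + aa 7 *s (\<Sum>k\<in>UNIV. xvec k)
                + bb 5 *s yvec i + bb 6 *s yvec j + bb 7 *s (\<Sum>k\<in>UNIV. yvec k))
          (\<lambda>i j. aa 2 *s (xvec i - xvec j) + bb 2 *s (yvec i - yvec j))
      else (\<lambda>u v. 0))"

definition \<kappa>C_one ::
    "complex \<Rightarrow> complex \<Rightarrow> ('n \<Rightarrow> 'n) \<Rightarrow> 'n::finite dbl \<Rightarrow> 'n dbl \<Rightarrow> complex" where
  "\<kappa>C_one \<alpha> \<beta> g =
     (if g = id then
        bilinear_of_table times (\<lambda>i j. 0) (\<lambda>i j. if i = j then \<alpha> else \<beta>) (\<lambda>i j. 0)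
      else (\<lambda>u v. 0))"

definition is_transposition :: "('n \<Rightarrow> 'n) \<Rightarrow> bool" where
  "is_transposition g \<longleftrightarrow> (\<exists>r s. r \<noteq> s \<and> g = Transposition.transpose r s)"

text \<open>
  For \<open>g = (r s)\<close> the set \<open>{r, s}\<close> is recovered as the set of points moved by \<open>g\<close>.
\<close>

definition ref_vec ::
    "complex \<Rightarrow> complex \<Rightarrow> complex \<Rightarrow> complex \<Rightarrow> ('n \<Rightarrow> 'n) \<Rightarrow> 'n::finite dbl" where
  "ref_vec a a' b b' g =
     a *s (\<Sum>i | g i \<noteq> i. xvec i) + a' *s ((\<Sum>i\<in>UNIV. xvec i) - (\<Sum>i | g i \<noteq> i. xvec i)) +
     b *s (\<Sum>i | g i \<noteq> i. yvec i) + b' *s ((\<Sum>i\<in>UNIV. yvec i) - (\<Sum>i | g i \<noteq> i. yvec i))"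

definition \<kappa>L_ref ::
    "complex \<Rightarrow> complex \<Rightarrow> complex \<Rightarrow> complex \<Rightarrow> ('n \<Rightarrow> 'n)
      \<Rightarrow> 'n::finite dbl \<Rightarrow> 'n dbl \<Rightarrow> 'n dbl" where
  "\<kappa>L_ref a a' b b' g =
     (if is_transposition g then
        bilinear_of_table vector_scalar_mult (\<lambda>i j. 0)
          (\<lambda>i j. if g i \<noteq> i \<and> i = j then ref_vec a a' b b' g
                 else if g i \<noteq> i \<and> j = g i then - ref_vec a a' b b' g
                 else 0)
          (\<lambda>i j. 0)
      else (\<lambda>u v. 0))"

definition \<kappa>C_ref ::
    "complex \<Rightarrow> ('n \<Rightarrow> 'n) \<Rightarrow> 'n::finite dbl \<Rightarrow> 'n dbl \<Rightarrow> complex" where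
  "\<kappa>C_ref c g =
     (if is_transposition g then
        bilinear_of_table times (\<lambda>i j. 0)
          (\<lambda>i j. if g i \<noteq> i \<and> i = j then c
                 else if g i \<noteq> i \<and> j = g i then - c
                 else 0)
          (\<lambda>i j. 0)
      else (\<lambda>u v. 0))"

text \<open>
  \<open>cycle_of_list [i, j, k]\<close> maps \<open>i\<close> to \<open>j\<close>, \<open>j\<close> to \<open>k\<close> and \<open>k\<close> to \<open>i\<close>.
\<close>

definition is_three_cycle :: "('n \<Rightarrow> 'n) \<Rightarrow> bool" where
  "is_three_cycle g \<longleftrightarrow> (\<exists>i j k. distinct [i, j, k] \<and> g = cycle_of_list [i, j, k])"

text \<open>
  For a 3-cycle \<open>g\<close>, the sign is \<open>1\<close> on the pairs \<open>(i, j)\<close>, \<open>(j, k)\<close>, \<open>(k, i)\<close> with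
  \<open>g = (i j k)\<close>, it is \<open>-1\<close> on the reversed pairs, and \<open>0\<close> on all other pairs of indices.
\<close>

definition cyc_sign :: "('n \<Rightarrow> 'n) \<Rightarrow> 'n \<Rightarrow> 'n \<Rightarrow> complex" where
  "cyc_sign g p q =
     (if g p \<noteq> p \<and> q = g p then 1 else if g q \<noteq> q \<and> p = g q then - 1 else 0)"

definition \<kappa>C_3cyc ::
    "complex \<Rightarrow> complex \<Rightarrow> complex \<Rightarrow> complex \<Rightarrow> ('n \<Rightarrow> 'n)
      \<Rightarrow> 'n::finite dbl \<Rightarrow> 'n dbl \<Rightarrow> complex" where
  "\<kappa>C_3cyc a a' b b' g =
     (if is_three_cycle g then
        bilinear_of_table times
          (\<lambda>i j. cyc_sign g i j * (b' - b)\<^sup>2)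
          (\<lambda>i j. cyc_sign g i j * (- (a' - a) * (b' - b)))
          (\<lambda>i j. cyc_sign g i j * (a' - a)\<^sup>2)
      else (\<lambda>u v. 0))"

section \<open>Values on the basis\<close>

lemma bilinear_of_table_basis:
  assumes "\<And>w. smul 1 w = w" "\<And>w. smul 0 w = 0"
  shows "bilinear_of_table smul xx xy yy (axis p 1) (axis q 1) = skew_table xx xy yy p q"
proof -
  have "smul (axis p 1 $ p' * axis q 1 $ q') w = (if p' = p then if q' = q then w else 0 else 0)"
    for p' q' w
    using assms by (auto simp: axis_def)
  then have "bilinear_of_table smul xx xy yy (axis p 1) (axis q 1) =
      (\<Sum>p'\<in>UNIV. if p' = p then \<Sum>q'\<in>UNIV. if q' = q then skew_table xx xy yy p' q' else 0 else 0)"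
    unfolding bilinear_of_table_def by (intro sum.cong) auto
  then show ?thesis
    by simp
qed

lemmas bilinear_of_table_xy_basis =
  bilinear_of_table_basis[where smul = vector_scalar_mult, simplified]
  bilinear_of_table_basis[where smul = times, simplified]

lemma doubled_perm_action_basis:
  fixes \<sigma> :: "'n::finite \<Rightarrow> 'n"
  shows "doubled_perm_action \<sigma> (xvec i) = xvec (\<sigma> i)"
  "doubled_perm_action \<sigma> (yvec i) = yvec (\<sigma> i)"
proof -
  have *: "axis i (1::complex) $ j *s w = (if j = i then w else 0)" for i j :: "'n + 'n" and w :: "'n dbl"
    by (simp add: axis_def)
  show "doubled_perm_action \<sigma> (xvec i) = xvec (\<sigma> i)"
    "doubled_perm_action \<sigma> (yvec i) = yvec (\<sigma> i)"
    unfolding doubled_perm_action_def xvec_def[of i] yvec_def[of i] * by simp_all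
qed

lemma ref_vec_transpose:
  assumes "r \<noteq> s"
  shows "ref_vec a a' b b' (Transposition.transpose r s) =
    a *s (xvec r + xvec s) + a' *s ((\<Sum>i\<in>UNIV. xvec i) - (xvec r + xvec s)) +
    b *s (yvec r + yvec s) + b' *s ((\<Sum>i\<in>UNIV. yvec i) - (yvec r + yvec s))"
proof -
  have "{i. Transposition.transpose r s i \<noteq> i} = {r, s}"
    using assms by (auto simp: Transposition.transpose_def)
  then show ?thesis
    using assms by (simp add: ref_vec_def)
qed

lemma \<kappa>_ref_transpose:
  assumes "r \<noteq> s"
  defines "g \<equiv> Transposition.transpose r s"
  shows "\<kappa>L_ref a a' b b' g (xvec i) (yvec j) =
      (if i = j \<and> i \<in> {r, s} then ref_vec a a' b b' g
       else if {i, j} = {r, s} then - ref_vec a a' b b' g else 0)"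
    and "\<kappa>C_ref c g (xvec i) (yvec j) =
      (if i = j \<and> i \<in> {r, s} then c else if {i, j} = {r, s} then - c else 0)"
proof -
  have "is_transposition g"
    using assms by (auto simp: is_transposition_def)
  moreover have "g i \<noteq> i \<longleftrightarrow> i \<in> {r, s}" "g i \<noteq> i \<and> j = g i \<longleftrightarrow> {i, j} = {r, s}"
    using assms by (auto simp: Transposition.transpose_def doubleton_eq_iff)
  ultimately show "\<kappa>L_ref a a' b b' g (xvec i) (yvec j) =
      (if i = j \<and> i \<in> {r, s} then ref_vec a a' b b' g
       else if {i, j} = {r, s} then - ref_vec a a' b b' g else 0)"
    and "\<kappa>C_ref c g (xvec i) (yvec j) =
      (if i = j \<and> i \<in> {r, s} then c else if {i, j} = {r, s} then - c else 0)"
    by (auto simp: \<kappa>L_ref_def \<kappa>C_ref_def xvec_def yvec_def bilinear_of_table_xy_basis)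
qed

lemma \<kappa>C_3cyc_cycle:
  assumes "distinct [i, j, k]"
  defines "g \<equiv> cycle_of_list [i, j, k]"
  shows "\<kappa>C_3cyc a a' b b' g (xvec i) (xvec j) = (b' - b)\<^sup>2"
    and "\<kappa>C_3cyc a a' b b' g (yvec i) (yvec j) = (a' - a)\<^sup>2"
    and "\<kappa>C_3cyc a a' b b' g (xvec i) (yvec j) = - (a' - a) * (b' - b)"
    and "\<kappa>C_3cyc a a' b b' g (yvec i) (xvec j) = - (a' - a) * (b' - b)"
proof -
  have "is_three_cycle g"
    using assms unfolding is_three_cycle_def by blast
  moreover have "g i = j" "g j = k"
    using assms by (auto simp: Transposition.transpose_def)
  ultimately show "\<kappa>C_3cyc a a' b b' g (xvec i) (xvec j) = (b' - b)\<^sup>2"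
    and "\<kappa>C_3cyc a a' b b' g (yvec i) (yvec j) = (a' - a)\<^sup>2"
    and "\<kappa>C_3cyc a a' b b' g (xvec i) (yvec j) = - (a' - a) * (b' - b)"
    and "\<kappa>C_3cyc a a' b b' g (yvec i) (xvec j) = - (a' - a) * (b' - b)"
    using assms(1)
    by (auto simp: \<kappa>C_3cyc_def cyc_sign_def xvec_def yvec_def bilinear_of_table_xy_basis)
qed

end

theory Submission
  imports Defs
begin

text \<open>
  Write a vector of \<open>V\<close> as a family of points \<open>v\<^sub>i = (\<xi>\<^sub>i, \<eta>\<^sub>i)\<close> of the plane \<open>\<complex>\<^sup>2\<close>, its sites, with \<open>\<xi>\<^sub>i\<close> and
  \<open>\<eta>\<^sub>i\<close> the coefficients of \<open>x\<^sub>i\<close> and \<open>y\<^sub>i\<close>.  A permutation moves the sites, and all component maps are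
  built from the symplectic form \<open>det2\<close> of the plane.  Put \<open>d = (a, b)\<close>, \<open>d' = (a', b')\<close> and
  \<open>e = d' - d\<close>, and let \<open>\<Sigma>v\<close> be the sum of the sites.  Under the conditions on the parameters:
  \<^item> at the identity, \<open>\<kappa>\<^sup>L(u, v) = det2 (\<Sigma>u) (\<Sigma>v) t\<close> with a vector \<open>t\<close> that is constant along the sites,
    and \<open>\<kappa>\<^sup>C(u, v) = \<alpha> det2 (\<Sigma>u) (\<Sigma>v)\<close>;
  \<^item> at a transposition \<open>g = (r s)\<close>, \<open>\<kappa>\<^sup>L(u, v) = det2 (u\<^sub>r - u\<^sub>s) (v\<^sub>r - v\<^sub>s) U\<close>, where \<open>U\<close> has the value \<open>d\<close> at \<open>r\<close> and
    \<open>s\<close> and \<open>d'\<close> elsewhere, and \<open>\<kappa>\<^sup>C\<close> has the constant \<open>c\<close> in place of \<open>U\<close>;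
  \<^item> at a 3-cycle \<open>(i j k)\<close>, \<open>\<kappa>\<^sup>C(u, v)\<close> is the determinant with rows \<open>(1, 1, 1)\<close>, \<open>\<lambda>(u)\<close>, \<open>\<lambda>(v)\<close> in the
    sites \<open>i, j, k\<close>, where \<open>\<lambda> = det2 e\<close>.

  In this form conditions (0) and (i) are reindexings, and condition (ii) is Pluecker's relation
  \<open>det2 q r p + det2 r p q + det2 p q r = 0\<close> in the plane.

  Conditions (iii) and (iv) are sums over factorizations \<open>g = x y\<close> in which the value of \<open>\<kappa>\<^sup>L\<close> at \<open>y\<close>, a
  multiple of \<open>t\<close> or of \<open>U\<close>, is an argument of the component at \<open>x\<close>.  Most of these terms vanish.
  Transpositions and 3-cycles do not see \<open>t\<close>; the identity does not see \<open>U\<close>, because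
  \<open>2 d + (n - 2) d' = 0\<close> says that \<open>\<Sigma>U = 0\<close>; 3-cycles do not see \<open>U\<close>, because \<open>\<lambda>\<close> has the same value at \<open>d\<close> and
  \<open>d'\<close>; and a transposition sees \<open>U\<close> only if it swaps a point moved by \<open>y\<close> with a fixed one
  (\<open>composition_sum\<close>).  There remain the three factorizations of a 3-cycle into two
  transpositions.  Their three coefficients add up to \<open>0\<close>, which is (iv)
  (\<open>overlap_term_sum_zero\<close>), while in (iii) they come with three vectors \<open>U\<close> that differ by
  multiples of \<open>e\<close> on the cycle, and the multiple of \<open>e\<close> that survives is the displacement of the
  arguments by \<open>g\<close>, weighted by the determinant above (\<open>overlap_term_cyc_form\<close>).
\<close>

section \<open>Pairs of coordinates and the symplectic form\<close>

text \<open>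
  The pair of coordinates of a vector at one index: \<open>V\<close> is viewed as the space of functions from
  indices to the plane \<open>\<complex>\<^sup>2\<close>, so that permutations merely move the sites.
\<close>

definition site :: "'n::finite dbl \<Rightarrow> 'n \<Rightarrow> complex \<times> complex" where
  "site v i = (v $ Inl i, v $ Inr i)"

definition det2 :: "complex \<times> complex \<Rightarrow> complex \<times> complex \<Rightarrow> complex" where
  "det2 p q = fst p * snd q - snd p * fst q"

definition site_sum :: "'n::finite dbl \<Rightarrow> complex \<times> complex" where
  "site_sum v = (\<Sum>i\<in>UNIV. site v i)"

lemma site_simps [simp]:
  "site (u + v) i = site u i + site v i"
  "site (u - v) i = site u i - site v i"
  "site (c *s v) i = (c * fst (site v i), c * snd (site v i))"
  "site 0 i = 0"
  by (simp_all add: site_def zero_prod_def)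

lemma site_sum_simps [simp]:
  "site_sum (u + v) = site_sum u + site_sum v"
  "site_sum (c *s v) = (c * fst (site_sum v), c * snd (site_sum v))"
  "site_sum 0 = 0"
  by (simp_all add: site_sum_def sum.distrib sum_distrib_left prod_eq_iff fst_sum snd_sum)

lemma dbl_eq_iff: "u = v \<longleftrightarrow> (\<forall>i. site u i = site v i)"
  for u v :: "'n::finite dbl"
  unfolding vec_eq_iff site_def by (metis Pair_inject sum.exhaust)

lemma det2_simps [simp]:
  "det2 (p + q) r = det2 p r + det2 q r" "det2 p (q + r) = det2 p q + det2 p r"
  "det2 (p - q) r = det2 p r - det2 q r" "det2 p (q - r) = det2 p q - det2 p r"
  "det2 (c * fst p, c * snd p) q = c * det2 p q" "det2 p (c * fst q, c * snd q) = c * det2 p q"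
  "det2 0 q = 0" "det2 p 0 = 0" "det2 p p = 0"
  by (simp_all add: det2_def algebra_simps)

lemma det2_skew: "det2 p q = - det2 q p"
  by (simp add: det2_def)

lemma sum_det2_site:
  "(\<Sum>i\<in>UNIV. \<Sum>j\<in>UNIV. det2 (site u i) (site v j)) = det2 (site_sum u) (site_sum v)"
  unfolding site_sum_def det2_def fst_sum snd_sum sum_product sum_subtractf by simp

text \<open>
  Three vectors in a plane satisfy one linear relation, whose coefficients are their \<open>2 \<times> 2\<close> minors.
  It evaluates all the cyclic sums below.
\<close>

lemma plucker:
  "det2 q r * fst p + det2 r p * fst q + det2 p q * fst r = 0"
  "det2 q r * snd p + det2 r p * snd q + det2 p q * snd r = 0"
  "det2 q r * det2 p s + det2 r p * det2 q s + det2 p q * det2 r s = 0"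
  by (simp_all add: det2_def algebra_simps)

text \<open>
  For each \<open>i\<close>, the terms with \<open>det2 e d\<^sub>i\<close> match by the preceding relation, applied to \<open>e\<close> and the two
  other \<open>c\<close>'s.
\<close>

lemma plucker_wedge:
  fixes e c1 c2 c3 d1 d2 d3 :: "complex \<times> complex"
  shows "fst e * (det2 e d1 * det2 c2 c3 + det2 e d2 * det2 c3 c1 + det2 e d3 * det2 c1 c2) =
    (det2 e c2 * det2 e d3 - det2 e d2 * det2 e c3) * fst c1 +
    (det2 e c3 * det2 e d1 - det2 e d3 * det2 e c1) * fst c2 +
    (det2 e c1 * det2 e d2 - det2 e d1 * det2 e c2) * fst c3"
   "snd e * (det2 e d1 * det2 c2 c3 + det2 e d2 * det2 c3 c1 + det2 e d3 * det2 c1 c2) =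
    (det2 e c2 * det2 e d3 - det2 e d2 * det2 e c3) * snd c1 +
    (det2 e c3 * det2 e d1 - det2 e d3 * det2 e c1) * snd c2 +
    (det2 e c1 * det2 e d2 - det2 e d1 * det2 e c2) * snd c3"
  by (simp_all add: det2_def algebra_simps)

section \<open>Transpositions, 3-cycles and conjugation\<close>

lemma transposition_involution: "is_transposition g \<Longrightarrow> g (g i) = i"
  by (auto simp: is_transposition_def)

lemma transposition_bij: "is_transposition g \<Longrightarrow> bij g"
  by (auto simp: is_transposition_def)

lemma transposition_not_id: "is_transposition g \<Longrightarrow> g \<noteq> id"
  unfolding is_transposition_def by (metis id_apply transpose_apply_first)

lemma moved_transpose: "r \<noteq> s \<Longrightarrow> {i. Transposition.transpose r s i \<noteq> i} = {r, s}"
  by (auto simp: Transposition.transpose_def)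

lemma three_cycleE:
  assumes "is_three_cycle g"
  obtains i where "distinct [i, g i, g (g i)]" "g (g (g i)) = i" "{q. g q \<noteq> q} = {i, g i, g (g i)}"
proof -
  obtain i j k where ijk: "distinct [i, j, k]" "g = cycle_of_list [i, j, k]"
    using assms unfolding is_three_cycle_def by blast
  then have g: "g i = j" "g j = k" "g k = i" "\<And>q. q \<notin> {i, j, k} \<Longrightarrow> g q = q"
    by (auto simp: Transposition.transpose_def)
  show ?thesis
  proof (rule that[of i])
    show "distinct [i, g i, g (g i)]" "g (g (g i)) = i"
      unfolding g(1-3) using ijk(1) by simp_all
    have "g q \<noteq> q \<longleftrightarrow> q \<in> {i, j, k}" for q
      using g(1,2,3) g(4)[of q] ijk(1) by (metis distinct_length_2_or_more insertE insert_iff empty_iff)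
    then show "{q. g q \<noteq> q} = {i, g i, g (g i)}"
      unfolding g(1-3) by blast
  qed
qed

lemma three_cycle_cube: "is_three_cycle g \<Longrightarrow> g (g (g i)) = i"
  by (erule three_cycleE) (metis (mono_tags, lifting) insertE mem_Collect_eq singletonD)

lemma three_cycle_no_return:
  assumes "is_three_cycle g" "g i \<noteq> i"
  shows "g (g i) \<noteq> i"
  using assms three_cycle_cube by metis

text \<open>
  Any of the three moved points can serve as the starting point of the cycle.
\<close>

lemma three_cycle_at_moved_point:
  assumes g: "is_three_cycle g" and i: "g i \<noteq> i"
  shows "distinct [i, g i, g (g i)]" "g (g (g i)) = i" "{q. g q \<noteq> q} = {i, g i, g (g i)}"
proof -
  show "g (g (g i)) = i"
    by (rule three_cycle_cube[OF g])
  then show "distinct [i, g i, g (g i)]"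
    using i three_cycle_no_return[OF g i] by (metis distinct_length_2_or_more distinct_singleton)
  obtain k where k: "g (g (g k)) = k" "{q. g q \<noteq> q} = {k, g k, g (g k)}"
    using g by (rule three_cycleE)
  then consider "i = k" | "i = g k" | "i = g (g k)"
    using i by blast
  then show "{q. g q \<noteq> q} = {i, g i, g (g i)}"
    unfolding k(2) by cases (simp_all only: k(1) insert_commute)
qed

lemma three_cycle_not_transposition:
  assumes "is_three_cycle g"
  shows "\<not> is_transposition g" "g \<noteq> id"
proof -
  obtain i where "distinct [i, g i, g (g i)]"
    using assms by (rule three_cycleE)
  then show "\<not> is_transposition g" "g \<noteq> id"
    using transposition_involution[of g i] by auto
qed

lemma conj_apply:
  assumes "bij h"
  shows "(h \<circ> g \<circ> inv_into UNIV h) (h i) = h (g i)"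
  using assms by (simp add: bij_is_inj)

lemma conj_cancel:
  assumes "bij h"
  shows "inv_into UNIV h \<circ> (h \<circ> g \<circ> inv_into UNIV h) \<circ> inv_into UNIV (inv_into UNIV h) = g"
  using assms by (simp add: fun_eq_iff inv_inv_eq bij_is_inj)

lemma conj_eq_id_iff:
  assumes "bij h"
  shows "h \<circ> g \<circ> inv_into UNIV h = id \<longleftrightarrow> g = id"
proof
  assume "h \<circ> g \<circ> inv_into UNIV h = id"
  then show "g = id"
    using conj_cancel[OF assms, of g] assms by (simp add: bij_is_inj bij_imp_bij_inv inv_inv_eq)
qed (use assms in \<open>simp add: fun_eq_iff bij_is_surj surj_f_inv_f\<close>)

text \<open>
  It is enough to show that conjugation preserves transpositions, since it can be undone by
  conjugation with the inverse; the same applies to 3-cycles below.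
\<close>

lemma is_transposition_conj:
  fixes g h :: "'a \<Rightarrow> 'a"
  assumes "bij h"
  shows "is_transposition (h \<circ> g \<circ> inv_into UNIV h) \<longleftrightarrow> is_transposition g"
proof -
  have *: "is_transposition (h \<circ> g \<circ> inv_into UNIV h)" if gh: "bij h" "is_transposition g" for g h :: "'a \<Rightarrow> 'a"
  proof -
    obtain r s where rs: "r \<noteq> s" "g = Transposition.transpose r s"
      using gh by (auto simp: is_transposition_def)
    have "h \<circ> g = Transposition.transpose (h r) (h s) \<circ> h"
      using gh(1) by (auto simp: rs Transposition.transpose_def fun_eq_iff inj_eq[OF bij_is_inj])
    then have "h \<circ> g \<circ> inv_into UNIV h = Transposition.transpose (h r) (h s)"
      using gh(1) by (simp add: fun_eq_iff surj_f_inv_f bij_is_surj)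
    moreover have "h r \<noteq> h s"
      using rs gh(1) by (simp add: bij_is_inj inj_eq)
    ultimately show ?thesis
      unfolding is_transposition_def by blast
  qed
  show ?thesis
    using *[OF assms, of g] *[OF bij_imp_bij_inv[OF assms], of "h \<circ> g \<circ> inv_into UNIV h"] conj_cancel[OF assms, of g]
    by auto
qed

lemma is_three_cycle_conj:
  fixes g h :: "'a \<Rightarrow> 'a"
  assumes "bij h"
  shows "is_three_cycle (h \<circ> g \<circ> inv_into UNIV h) \<longleftrightarrow> is_three_cycle g"
proof -
  have *: "is_three_cycle (h \<circ> g \<circ> inv_into UNIV h)" if gh: "bij h" "is_three_cycle g" for g h :: "'a \<Rightarrow> 'a"
  proof -
    obtain i j k where ijk: "distinct [i, j, k]" "g = cycle_of_list [i, j, k]"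
      using gh unfolding is_three_cycle_def by blast
    have "h \<circ> g \<circ> inv_into UNIV h = cycle_of_list [h i, h j, h k]"
      using conjugation_of_cycle[OF ijk(1) gh(1)] unfolding ijk(2) by simp
    moreover have "distinct [h i, h j, h k]"
      using ijk(1) gh(1) by (auto simp: bij_is_inj inj_eq)
    ultimately show ?thesis
      unfolding is_three_cycle_def by blast
  qed
  show ?thesis
    using *[OF assms, of g] *[OF bij_imp_bij_inv[OF assms], of "h \<circ> g \<circ> inv_into UNIV h"] conj_cancel[OF assms, of g]
    by auto
qed

section \<open>The doubled permutation action\<close>

lemma sum_UNIV_Plus:
  "(\<Sum>p\<in>UNIV. f p) = (\<Sum>i\<in>UNIV. f (Inl i)) + (\<Sum>i\<in>UNIV. f (Inr i))"
  for f :: "'n::finite + 'n \<Rightarrow> 'b::comm_monoid_add"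
  using sum.Plus[of UNIV UNIV f] by (simp add: UNIV_Plus_UNIV o_def)

lemma xvec_yvec_nth [simp]:
  "xvec i $ Inl j = (if j = i then 1 else 0)" "xvec i $ Inr j = 0"
  "yvec i $ Inr j = (if j = i then 1 else 0)" "yvec i $ Inl j = 0"
  by (simp_all add: xvec_def yvec_def axis_def)

lemma site_action:
  assumes "bij h"
  shows "site (doubled_perm_action h v) i = site v (inv_into UNIV h i)"
proof -
  have "i = h j \<longleftrightarrow> j = inv_into UNIV h i" for j
    using assms by (metis bij_inv_eq_iff)
  then show ?thesis
    by (simp add: site_def doubled_perm_action_def if_distrib cong: if_cong)
qed

lemma site_action_image:
  assumes "bij h"
  shows "site (doubled_perm_action h v) (h i) = site v i"
  using assms by (simp add: site_action bij_is_inj)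

lemma act_transposition:
  assumes "is_transposition y"
  shows "site (doubled_perm_action y v) i = site v (y i)"
proof -
  have "inv_into UNIV y i = y i"
    using assms by (metis bij_inv_eq_iff transposition_bij transposition_involution)
  then show ?thesis
    using assms by (simp add: site_action transposition_bij)
qed

lemma site_sum_action [simp]:
  assumes "bij h"
  shows "site_sum (doubled_perm_action h v) = site_sum v"
  unfolding site_sum_def site_action[OF assms]
  by (rule sum.reindex_bij_betw) (simp add: assms bij_imp_bij_inv)

lemma doubled_perm_action_linear:
  "doubled_perm_action g (u + v) = doubled_perm_action g u + doubled_perm_action g v"
  "doubled_perm_action g (c *s v) = c *s doubled_perm_action g v"
  by (simp_all add: doubled_perm_action_def sum.distrib vec.scale_left_distrib vec.scale_sum_right
      vec.scale_right_distrib)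

lemma doubled_perm_action_comp:
  assumes "bij g" "bij h"
  shows "doubled_perm_action (g \<circ> h) v = doubled_perm_action g (doubled_perm_action h v)"
  using assms by (simp add: dbl_eq_iff site_action bij_comp o_inv_distrib)

lemma BijGroup_UNIV [simp]:
  fixes g h :: "'n \<Rightarrow> 'n"
  shows "carrier (BijGroup UNIV) = {g :: 'n \<Rightarrow> 'n. bij g}"
    and "bij g \<Longrightarrow> bij h \<Longrightarrow> g \<otimes>\<^bsub>BijGroup UNIV\<^esub> h = g \<circ> h"
    and "bij h \<Longrightarrow> inv\<^bsub>BijGroup UNIV\<^esub> h = inv_into UNIV h"
proof -
  have Bij: "Bij (UNIV :: 'n set) = {g. bij g}"
    by (auto simp: Bij_def)
  show "carrier (BijGroup UNIV) = {g :: 'n \<Rightarrow> 'n. bij g}"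
    by (simp add: BijGroup_def Bij)
  show "g \<otimes>\<^bsub>BijGroup UNIV\<^esub> h = g \<circ> h" if "bij g" "bij h"
    using that by (simp add: BijGroup_def Bij compose_def fun_eq_iff)
  show "inv\<^bsub>BijGroup UNIV\<^esub> h = inv_into UNIV h" if "bij h"
    using that by (subst inv_BijGroup) (simp_all add: Bij fun_eq_iff)
qed

lemma doubled_perm_action_linear_group_action:
  "linear_group_action (BijGroup (UNIV :: 'n::finite set)) doubled_perm_action"
proof -
  have "bij (doubled_perm_action g)" if "bij g" for g :: "'n \<Rightarrow> 'n"
  proof (rule o_bij)
    have id: "doubled_perm_action id v = v" for v :: "'n dbl"
      by (simp add: dbl_eq_iff site_action)
    have inv: "inv_into UNIV g \<circ> g = id" "g \<circ> inv_into UNIV g = id" "bij (inv_into UNIV g)"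
      using that bij_is_inj[OF that] bij_is_surj[OF that] by (auto simp: surj_iff bij_imp_bij_inv)
    show "doubled_perm_action (inv_into UNIV g) \<circ> doubled_perm_action g = id"
      "doubled_perm_action g \<circ> doubled_perm_action (inv_into UNIV g) = id"
      using that by (simp_all add: fun_eq_iff doubled_perm_action_comp[symmetric] inv(3))
        (simp_all only: inv(1,2) id simp_thms)
  qed
  then have "group_action (BijGroup (UNIV :: 'n set)) UNIV doubled_perm_action"
    by (auto simp: group_action_def group_hom_def group_hom_axioms_def hom_def group_BijGroup
        doubled_perm_action_comp fun_eq_iff)
  moreover have "finite {g :: 'n \<Rightarrow> 'n. bij g}"
    by simp
  ultimately show ?thesis
    by (auto simp: linear_group_action_def Vector_Spaces.linear_iff vec.vector_space_axioms
        doubled_perm_action_linear)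
qed

section \<open>Invariant skew forms on transpositions and 3-cycles\<close>

text \<open>
  For \<open>g = (r s)\<close> this is \<open>det2 (u\<^sub>r - u\<^sub>s) (v\<^sub>r - v\<^sub>s)\<close>; summing over all sites avoids a choice of \<open>r\<close>
  and \<open>s\<close> and makes conjugation a reindexing.
\<close>

definition refl_form :: "('n \<Rightarrow> 'n) \<Rightarrow> 'n::finite dbl \<Rightarrow> 'n dbl \<Rightarrow> complex" where
  "refl_form g u v = (\<Sum>i\<in>UNIV. det2 (site u i) (site v i - site v (g i)))"

text \<open>
  With \<open>\<lambda> = det2 e\<close> and \<open>g = (i j k)\<close> this is the determinant of the three rows \<open>(1, 1, 1)\<close>,
  \<open>(\<lambda> u\<^sub>i, \<lambda> u\<^sub>j, \<lambda> u\<^sub>k)\<close> and \<open>(\<lambda> v\<^sub>i, \<lambda> v\<^sub>j, \<lambda> v\<^sub>k)\<close>; the fixed points of \<open>g\<close> contribute \<open>0\<close>.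
\<close>

definition cyc_form ::
    "complex \<times> complex \<Rightarrow> ('n \<Rightarrow> 'n) \<Rightarrow> 'n::finite dbl \<Rightarrow> 'n dbl \<Rightarrow> complex" where
  "cyc_form e g u v =
     (\<Sum>i\<in>UNIV. det2 e (site u i) * det2 e (site v (g i)) - det2 e (site u (g i)) * det2 e (site v i))"

text \<open>
  One scalar family that covers both halves of the map: the constant part is an instance, and so is
  each coordinate of the linear part, with \<open>r = 0\<close>.  Bilinearity, skew-symmetry, invariance and the
  double sums over factorizations are therefore treated once.
\<close>

definition orbifold_form ::
    "complex \<times> complex \<Rightarrow> complex \<Rightarrow> complex \<Rightarrow> complex \<Rightarrow> ('n \<Rightarrow> 'n)
      \<Rightarrow> 'n::finite dbl \<Rightarrow> 'n dbl \<Rightarrow> complex" where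
  "orbifold_form e p q r g u v =
     (if g = id then p * det2 (site_sum u) (site_sum v) else 0) +
     (if is_transposition g then q * refl_form g u v else 0) +
     (if is_three_cycle g then r * cyc_form e g u v else 0)"

lemma refl_form_transpose:
  assumes "r \<noteq> s"
  shows "refl_form (Transposition.transpose r s) u v = det2 (site u r - site u s) (site v r - site v s)"
proof -
  let ?g = "Transposition.transpose r s"
  have "refl_form ?g u v = (\<Sum>i\<in>{r, s}. det2 (site u i) (site v i - site v (?g i)))"
    unfolding refl_form_def
    by (rule sum.mono_neutral_right) auto
  then show ?thesis
    using assms by simp
qed

lemma refl_form_sym:
  assumes "is_transposition g"
  shows "refl_form g u v = - refl_form g v u"
proof -
  obtain r s where "r \<noteq> s" "g = Transposition.transpose r s"
    using assms by (auto simp: is_transposition_def)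
  then show ?thesis
    by (simp add: refl_form_transpose) (simp add: det2_def algebra_simps)
qed

lemma refl_form_const:
  assumes "\<And>i. site w i = s"
  shows "refl_form x u w = 0"
  by (simp add: refl_form_def assms)

lemma cyc_form_three_cycle:
  assumes "distinct [i, g i, g (g i)]" "g (g (g i)) = i" "{q. g q \<noteq> q} = {i, g i, g (g i)}"
  shows "cyc_form e g u v =
    det2 e (site u i - site u (g i)) * det2 e (site v (g i) - site v (g (g i))) -
    det2 e (site u (g i) - site u (g (g i))) * det2 e (site v i - site v (g i))"
proof -
  have "cyc_form e g u v = (\<Sum>i\<in>{q. g q \<noteq> q}.
      det2 e (site u i) * det2 e (site v (g i)) - det2 e (site u (g i)) * det2 e (site v i))"
    unfolding cyc_form_def by (rule sum.mono_neutral_right) auto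
  then show ?thesis
    unfolding assms(3) using assms(1,2) by (simp add: algebra_simps)
qed

lemma sum_comp_bij:
  fixes g :: "'n::finite \<Rightarrow> 'n"
  assumes "bij g"
  shows "(\<Sum>i\<in>UNIV. f (g i)) = (\<Sum>i\<in>UNIV. f i)"
  using assms by (rule sum.reindex_bij_betw)

text \<open>
  The 3-cycle part does not see vectors along which \<open>det2 e\<close> is constant, such as \<open>t\<close> and \<open>U g\<close>: the two
  halves of the sum become equal after reindexing by \<open>x\<close>.
\<close>

lemma cyc_form_const:
  assumes "bij x" "\<And>i. det2 e (site w i) = s"
  shows "cyc_form e x u w = 0"
  unfolding cyc_form_def assms(2) sum_subtractf
  by (simp add: sum_comp_bij[OF assms(1), of "\<lambda>i. det2 e (site u i) * s"])

lemma orbifold_form_add_right: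
  "orbifold_form e p q r g u (v + w) = orbifold_form e p q r g u v + orbifold_form e p q r g u w"
  by (simp add: orbifold_form_def refl_form_def cyc_form_def ring_distribs sum.distrib sum_subtractf)

lemma orbifold_form_scale_right:
  "orbifold_form e p q r g u (c *s v) = c * orbifold_form e p q r g u v"
proof -
  have refl: "refl_form g u (c *s v) = c * refl_form g u v"
    by (simp add: refl_form_def sum_distrib_left det2_def algebra_simps)
  have cyc: "cyc_form e g u (c *s v) = c * cyc_form e g u v"
    by (simp add: cyc_form_def sum_distrib_left algebra_simps)
  show ?thesis
    unfolding orbifold_form_def refl cyc by (simp add: algebra_simps)
qed

lemma orbifold_form_skew: "orbifold_form e p q r g u v = - orbifold_form e p q r g v u"
proof -
  have "cyc_form e g u v = - cyc_form e g v u"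
    by (simp add: cyc_form_def sum_negf[symmetric] mult.commute)
  then show ?thesis
    using refl_form_sym[of g u v] det2_skew[of "site_sum u" "site_sum v"]
    by (auto simp: orbifold_form_def)
qed

lemma orbifold_form_add_left:
  "orbifold_form e p q r g (u + v) w = orbifold_form e p q r g u w + orbifold_form e p q r g v w"
  using orbifold_form_add_right[of e p q r g w u v] by (metis orbifold_form_skew minus_add_distrib)

lemma orbifold_form_scale_left:
  "orbifold_form e p q r g (c *s u) v = c * orbifold_form e p q r g u v"
  using orbifold_form_scale_right[of e p q r g v c u] by (metis orbifold_form_skew mult_minus_right)

lemma orbifold_form_skew_bilinear: "skew_bilinear times (orbifold_form e p q r g)"
  unfolding skew_bilinear_def Vector_Spaces.linear_iff
  by (auto simp: vec.vector_space_axioms vector_space_over_itself.vector_space_axioms orbifold_form_add_right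
      orbifold_form_add_left orbifold_form_scale_right orbifold_form_scale_left intro: orbifold_form_skew)

lemma refl_form_conj:
  assumes "bij h"
  shows "refl_form (h \<circ> g \<circ> inv_into UNIV h) (doubled_perm_action h u) (doubled_perm_action h v) =
    refl_form g u v"
  unfolding refl_form_def
  by (subst sum_comp_bij[OF assms, symmetric]) (simp only: conj_apply[OF assms] site_action_image[OF assms])

lemma cyc_form_conj:
  assumes "bij h"
  shows "cyc_form e (h \<circ> g \<circ> inv_into UNIV h) (doubled_perm_action h u) (doubled_perm_action h v) =
    cyc_form e g u v"
  unfolding cyc_form_def
  by (subst sum_comp_bij[OF assms, symmetric]) (simp only: conj_apply[OF assms] site_action_image[OF assms])

lemma orbifold_form_conj:
  assumes "bij h"
  shows "orbifold_form e p q r (h \<circ> g \<circ> inv_into UNIV h) (doubled_perm_action h u) (doubled_perm_action h v) =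
    orbifold_form e p q r g u v"
  unfolding orbifold_form_def is_transposition_conj[OF assms] is_three_cycle_conj[OF assms]
    conj_eq_id_iff[OF assms]
  by (simp only: refl_form_conj[OF assms] cyc_form_conj[OF assms] site_sum_action[OF assms])

text \<open>
  A transposition changes a vector by a multiple of the difference of two sites, so this is Pluecker's
  relation for the three differences.  It gives condition (ii), and shows that the right-hand side of
  condition (iii) vanishes on transpositions.
\<close>

lemma refl_form_cyclic_sum:
  assumes g: "is_transposition g"
  shows "refl_form g v w *s (doubled_perm_action g u - u) + refl_form g w u *s (doubled_perm_action g v - v) +
    refl_form g u v *s (doubled_perm_action g w - w) = 0"
proof -
  obtain r s where rs: "r \<noteq> s" "g = Transposition.transpose r s"
    using g by (auto simp: is_transposition_def)
  define D where "D u = site u r - site u s" for u :: "'a dbl"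
  have act: "site (doubled_perm_action g u - u) i = (if i = r then - D u else if i = s then D u else 0)" for u i
    using rs(1) unfolding site_simps act_transposition[OF g] by (auto simp: rs(2) D_def)
  have refl: "refl_form g u v = det2 (D u) (D v)" for u v
    unfolding rs(2) refl_form_transpose[OF rs(1)] D_def ..
  show ?thesis
    unfolding dbl_eq_iff site_simps(1,3,4) act refl
    using plucker(1,2)[of "D v" "D w" "D u"]
    by (auto simp: prod_eq_iff algebra_simps neg_eq_iff_add_eq_0)
qed

section \<open>Closed forms of the component maps\<close>

text \<open>
  A table that is symmetric on the mixed pairs \<open>(x\<^sub>i, y\<^sub>j)\<close> and zero on the pure ones pairs any two sites
  through the symplectic form, because the extension to \<open>(y\<^sub>i, x\<^sub>j)\<close> changes the sign.
\<close>

lemma bilinear_of_table_det2: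
  assumes "vector_space smul" and sym: "\<And>i j. m i j = m j i"
  shows "bilinear_of_table smul (\<lambda>i j. 0) (\<lambda>i j. smul (m i j) w) (\<lambda>i j. 0) u v =
    smul (\<Sum>i\<in>UNIV. \<Sum>j\<in>UNIV. m i j * det2 (site u i) (site v j)) w"
proof -
  interpret vector_space smul by fact
  have "skew_table (\<lambda>i j. 0) (\<lambda>i j. smul (m i j) w) (\<lambda>i j. 0) p q =
      smul (skew_table (\<lambda>i j. 0) m (\<lambda>i j. 0) p q) w" for p q
    by (cases p; cases q) simp_all
  then have "bilinear_of_table smul (\<lambda>i j. 0) (\<lambda>i j. smul (m i j) w) (\<lambda>i j. 0) u v =
      smul (\<Sum>p\<in>UNIV. \<Sum>q\<in>UNIV. u $ p * v $ q * skew_table (\<lambda>i j. 0) m (\<lambda>i j. 0) p q) w"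
    by (simp add: bilinear_of_table_def scale_sum_left)
  also have "(\<Sum>p\<in>UNIV. \<Sum>q\<in>UNIV. u $ p * v $ q * skew_table (\<lambda>i j. 0) m (\<lambda>i j. 0) p q) =
      (\<Sum>i\<in>UNIV. \<Sum>j\<in>UNIV. m i j * det2 (site u i) (site v j))"
    unfolding sum_UNIV_Plus sum.distrib[symmetric]
    by (intro sum.cong refl) (simp add: det2_def site_def sym sum_subtractf sum.distrib algebra_simps)
  finally show ?thesis .
qed

lemma \<kappa>C_one_eq:
  "\<kappa>C_one \<alpha> \<alpha> g u v = (if g = id then \<alpha> * det2 (site_sum u) (site_sum v) else 0)"
  using bilinear_of_table_det2[OF vector_space_over_itself.vector_space_axioms, of "\<lambda>i j. 1" \<alpha> u v]
  by (simp add: \<kappa>C_one_def sum_det2_site mult.commute)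

lemma \<kappa>L_one_eq:
  fixes u v :: "'n::finite dbl"
  assumes "\<forall>i\<in>{1, 2, 3, 5, 6}. aa i = 0 \<and> bb i = 0" "aa 4 = aa 7" "bb 4 = bb 7"
  shows "\<kappa>L_one aa bb g u v = (if g = id then det2 (site_sum u) (site_sum v) else 0) *s
    (aa 7 *s (\<Sum>k\<in>UNIV. xvec k) + bb 7 *s (\<Sum>k\<in>UNIV. yvec k))"
proof -
  let ?T = "aa 7 *s (\<Sum>k\<in>UNIV. xvec k) + bb 7 *s (\<Sum>k\<in>UNIV. yvec k) :: 'n dbl"
  have "aa 1 = 0" "aa 2 = 0" "aa 3 = 0" "aa 5 = 0" "aa 6 = 0"
    "bb 1 = 0" "bb 2 = 0" "bb 3 = 0" "bb 5 = 0" "bb 6 = 0"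
    using assms(1) by blast+
  then have "\<kappa>L_one aa bb g u v =
      (if g = id then bilinear_of_table vector_scalar_mult (\<lambda>i j. 0) (\<lambda>i j. 1 *s ?T) (\<lambda>i j. 0) u v else 0)"
    using assms(2,3) by (simp add: \<kappa>L_one_def cong: if_cong)
  also have "\<dots> = (if g = id then det2 (site_sum u) (site_sum v) else 0) *s ?T"
    by (subst bilinear_of_table_det2[OF vec.vector_space_axioms]) (simp_all add: sum_det2_site)
  finally show ?thesis .
qed

text \<open>
  At a fixed point of \<open>g\<close> the table is zero, and so is the difference of the sites.
\<close>

lemma swap_table_row:
  "(\<Sum>j\<in>UNIV. (if g i \<noteq> i \<and> i = j then 1 else if g i \<noteq> i \<and> j = g i then - 1 else 0) *
      det2 (site u i) (site v j)) = det2 (site u i) (site v i - site v (g i))"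
proof (cases "g i = i")
  case False
  have "(\<Sum>j\<in>UNIV. (if g i \<noteq> i \<and> i = j then 1 else if g i \<noteq> i \<and> j = g i then - 1 else 0) *
      det2 (site u i) (site v j)) =
    (\<Sum>j\<in>{i, g i}. (if g i \<noteq> i \<and> i = j then 1 else if g i \<noteq> i \<and> j = g i then - 1 else 0) *
      det2 (site u i) (site v j))"
    by (rule sum.mono_neutral_right) auto
  then show ?thesis
    using False by simp
qed simp

lemma bilinear_of_swap_table:
  assumes "vector_space smul"
  assumes g: "is_transposition g"
  shows "bilinear_of_table smul (\<lambda>i j. 0)
    (\<lambda>i j. if g i \<noteq> i \<and> i = j then w else if g i \<noteq> i \<and> j = g i then - w else 0) (\<lambda>i j. 0) u v =
    smul (refl_form g u v) w"
proof -
  interpret vector_space smul by fact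
  let ?m = "\<lambda>i j. if g i \<noteq> i \<and> i = j then 1 else if g i \<noteq> i \<and> j = g i then - 1 else 0"
  have "(\<lambda>i j. if g i \<noteq> i \<and> i = j then w else if g i \<noteq> i \<and> j = g i then - w else 0) =
      (\<lambda>i j. smul (?m i j) w)"
    by (auto simp: fun_eq_iff)
  moreover have sym: "?m i j = ?m j i" for i j
    using transposition_involution[OF g, of i] transposition_involution[OF g, of j] by auto
  ultimately show ?thesis
    by (simp only: bilinear_of_table_det2[OF assms(1), of ?m, OF sym] swap_table_row refl_form_def)
qed

lemma \<kappa>C_ref_eq: "\<kappa>C_ref c g u v = (if is_transposition g then c * refl_form g u v else 0)"
  by (simp add: \<kappa>C_ref_def bilinear_of_swap_table vector_space_over_itself.vector_space_axioms mult.commute)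

lemma \<kappa>L_ref_eq:
  "\<kappa>L_ref a a' b b' g u v = (if is_transposition g then refl_form g u v else 0) *s ref_vec a a' b b' g"
  by (simp add: \<kappa>L_ref_def bilinear_of_swap_table vec.vector_space_axioms)

text \<open>
  A 3-cycle has no 2-cycles, so at most one of the two conditions holds unless \<open>i = j\<close> is fixed, where
  they cancel.
\<close>

lemma cyc_sign_three_cycle:
  assumes "is_three_cycle g"
  shows "cyc_sign g i j = (if j = g i then 1 else 0) - (if i = g j then 1 else 0)"
  using three_cycle_no_return[OF assms, of i] three_cycle_no_return[OF assms, of j]
  by (auto simp: cyc_sign_def)

text \<open>
  The prescribed values \<open>(b' - b)\<^sup>2\<close>, \<open>(a' - a)\<^sup>2\<close> and \<open>- (a' - a) (b' - b)\<close> are the products of the values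
  of \<open>det2 e\<close> on the basis vectors, where \<open>e = (a' - a, b' - b)\<close>.
\<close>

lemma \<kappa>C_3cyc_eq:
  "\<kappa>C_3cyc a a' b b' g u v = (if is_three_cycle g then cyc_form (a' - a, b' - b) g u v else 0)"
proof (cases "is_three_cycle g")
  case g: True
  let ?l = "\<lambda>v i. det2 (a' - a, b' - b) (site v i)"
  have skew: "cyc_sign g j i = - cyc_sign g i j" for i j
    by (simp add: cyc_sign_three_cycle[OF g])
  have "\<kappa>C_3cyc a a' b b' g u v = (\<Sum>i\<in>UNIV. \<Sum>j\<in>UNIV. cyc_sign g i j * (?l u i * ?l v j))"
    unfolding \<kappa>C_3cyc_def bilinear_of_table_def sum_UNIV_Plus sum.distrib[symmetric] if_P[OF g]
  proof (intro sum.cong refl)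
    fix i j
    show "u $ Inl i * v $ Inl j * skew_table (\<lambda>i j. cyc_sign g i j * (b' - b)\<^sup>2)
          (\<lambda>i j. cyc_sign g i j * (- (a' - a) * (b' - b))) (\<lambda>i j. cyc_sign g i j * (a' - a)\<^sup>2) (Inl i) (Inl j) +
        u $ Inl i * v $ Inr j * skew_table (\<lambda>i j. cyc_sign g i j * (b' - b)\<^sup>2)
          (\<lambda>i j. cyc_sign g i j * (- (a' - a) * (b' - b))) (\<lambda>i j. cyc_sign g i j * (a' - a)\<^sup>2) (Inl i) (Inr j) +
       (u $ Inr i * v $ Inl j * skew_table (\<lambda>i j. cyc_sign g i j * (b' - b)\<^sup>2)
          (\<lambda>i j. cyc_sign g i j * (- (a' - a) * (b' - b))) (\<lambda>i j. cyc_sign g i j * (a' - a)\<^sup>2) (Inr i) (Inl j) +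
        u $ Inr i * v $ Inr j * skew_table (\<lambda>i j. cyc_sign g i j * (b' - b)\<^sup>2)
          (\<lambda>i j. cyc_sign g i j * (- (a' - a) * (b' - b))) (\<lambda>i j. cyc_sign g i j * (a' - a)\<^sup>2) (Inr i) (Inr j)) =
        cyc_sign g i j * (?l u i * ?l v j)"
      by (simp add: skew[of j i] det2_def site_def power2_eq_square algebra_simps)
  qed
  also have "\<dots> = (\<Sum>i\<in>UNIV. \<Sum>j\<in>UNIV. (if j = g i then ?l u i * ?l v j else 0)) -
      (\<Sum>j\<in>UNIV. \<Sum>i\<in>UNIV. (if i = g j then ?l u i * ?l v j else 0))"
    unfolding cyc_sign_three_cycle[OF g] left_diff_distrib sum_subtractf
    by (subst (2) sum.swap) (intro arg_cong2[of _ _ _ _ "(-)"] sum.cong refl; simp)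
  also have "\<dots> = cyc_form (a' - a, b' - b) g u v"
    by (simp add: cyc_form_def sum_subtractf)
  finally show ?thesis
    using g by simp
qed (simp add: \<kappa>C_3cyc_def)

lemma site_ref_vec:
  "site (ref_vec a a' b b' g) i = (if g i \<noteq> i then (a, b) else (a', b'))"
proof -
  have "(\<Sum>k | g k \<noteq> k. f k $ l) = (\<Sum>k\<in>UNIV. if g k \<noteq> k then f k $ l else 0)"
    for f :: "'a \<Rightarrow> 'a dbl" and l
    by (simp add: sum.If_cases)
  then show ?thesis
    by (simp add: site_def ref_vec_def if_distrib cong: if_cong)
qed

text \<open>
  The condition \<open>2 a + (n - 2) a' = 2 b + (n - 2) b' = 0\<close> says exactly this: two sites carry
  \<open>(a, b)\<close> and the other \<open>n - 2\<close> carry \<open>(a', b')\<close>.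
\<close>

lemma site_sum_ref_vec:
  fixes a a' b b' :: complex and g :: "'n::finite \<Rightarrow> 'n"
  assumes g: "is_transposition g"
    and a: "2 * a + (of_nat CARD('n) - 2) * a' = 0" and b: "2 * b + (of_nat CARD('n) - 2) * b' = 0"
  shows "site_sum (ref_vec a a' b b' g) = 0"
proof -
  obtain r s where rs: "r \<noteq> s" "g = Transposition.transpose r s"
    using g by (auto simp: is_transposition_def)
  have moved: "{i. g i \<noteq> i} = {r, s}"
    unfolding rs(2) by (rule moved_transpose[OF rs(1)])
  have "(\<Sum>i\<in>UNIV. if g i \<noteq> i then c else c') = 2 * c + (of_nat CARD('n) - 2) * c'" for c c' :: complex
  proof -
    have "(\<Sum>i\<in>UNIV. if g i \<noteq> i then c else c') = (\<Sum>i\<in>UNIV. c' + (if g i \<noteq> i then c - c' else 0))"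
      by (intro sum.cong) auto
    also have "\<dots> = of_nat CARD('n) * c' + (\<Sum>i | g i \<noteq> i. c - c')"
      by (simp add: sum.distrib sum.If_cases)
    finally show ?thesis
      unfolding moved using rs(1) by (simp add: algebra_simps)
  qed
  from this[of a a'] this[of b b'] show ?thesis
    using a b unfolding site_sum_def site_ref_vec
    by (simp add: prod_eq_iff fst_sum snd_sum if_distrib cong: if_cong)
qed

lemma ref_vec_equivariant:
  assumes "bij h"
  shows "doubled_perm_action h (ref_vec a a' b b' g) = ref_vec a a' b b' (h \<circ> g \<circ> inv_into UNIV h)"
proof -
  have "h (g (inv_into UNIV h i)) = i \<longleftrightarrow> g (inv_into UNIV h i) = inv_into UNIV h i" for i
    using assms by (metis bij_inv_eq_iff)
  then show ?thesis
    by (simp add: dbl_eq_iff site_action[OF assms] site_ref_vec)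
qed

section \<open>The linear part\<close>

text \<open>
  The linear half of the map in closed form; \<open>t\<close> is the invariant vector at the identity and \<open>U g\<close>
  the vector at the transposition \<open>g\<close>.
\<close>

definition linear_part ::
    "'n::finite dbl \<Rightarrow> (('n \<Rightarrow> 'n) \<Rightarrow> 'n dbl) \<Rightarrow> ('n \<Rightarrow> 'n) \<Rightarrow> 'n dbl \<Rightarrow> 'n dbl \<Rightarrow> 'n dbl" where
  "linear_part t U g u v =
     (if g = id then det2 (site_sum u) (site_sum v) else 0) *s t +
     (if is_transposition g then refl_form g u v else 0) *s U g"

lemma linear_part_nth:
  "linear_part t U g u v $ k = orbifold_form e (t $ k) (U g $ k) 0 g u v"
  by (simp add: linear_part_def orbifold_form_def)

lemma linear_part_skew_bilinear: "skew_bilinear vector_scalar_mult (linear_part t U g)"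
  unfolding skew_bilinear_def Vector_Spaces.linear_iff vec_eq_iff
  by (auto simp: vec.vector_space_axioms linear_part_nth[where e = undefined] orbifold_form_add_right
      orbifold_form_add_left orbifold_form_scale_right orbifold_form_scale_left intro: orbifold_form_skew)

lemma linear_part_equivariant:
  assumes h: "bij h" and "doubled_perm_action h t = t"
    and "doubled_perm_action h (U g) = U (h \<circ> g \<circ> inv_into UNIV h)"
  shows "doubled_perm_action h (linear_part t U g u v) =
    linear_part t U (h \<circ> g \<circ> inv_into UNIV h) (doubled_perm_action h u) (doubled_perm_action h v)"
  unfolding linear_part_def doubled_perm_action_linear assms(2,3) is_transposition_conj[OF h] conj_eq_id_iff[OF h]
  by (simp only: refl_form_conj[OF h] site_sum_action[OF h])

lemma sym_of_vec_linear:
  "sym_of_vec 0 = 0"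
  "sym_of_vec (u + v) = sym_of_vec u + sym_of_vec v"
  "sym_of_vec (c *s v) = Poly_Mapping.single 0 c * sym_of_vec v"
  by (simp_all add: sym_of_vec_def single_add sum.distrib sum_distrib_left mult_single)

text \<open>
  All values at a transposition \<open>g\<close> lie on the line of \<open>U g\<close>, so that \<open>U g\<close> factors out in \<open>S(V)\<close>.
\<close>

lemma linear_part_cyclic_sum_zero:
  assumes "bij g"
  shows "sym_of_vec (linear_part t U g v w) * sym_of_vec (doubled_perm_action g u - u) +
    sym_of_vec (linear_part t U g w u) * sym_of_vec (doubled_perm_action g v - v) +
    sym_of_vec (linear_part t U g u v) * sym_of_vec (doubled_perm_action g w - w) = 0"
proof (cases "is_transposition g")
  case True
  have "sym_of_vec (linear_part t U g v w) * sym_of_vec z = sym_of_vec (U g) * sym_of_vec (refl_form g v w *s z)"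
    for v w z
    using True transposition_not_id[OF True]
    by (simp add: linear_part_def sym_of_vec_linear mult_ac)
  then show ?thesis
    using refl_form_cyclic_sum[OF True, of v w u]
    by (simp add: distrib_left[symmetric] sym_of_vec_linear(1) sym_of_vec_linear(2)[symmetric])
next
  case False
  have "doubled_perm_action id u = u" for u :: "'a dbl"
    by (simp add: dbl_eq_iff site_action)
  then show ?thesis
    using False by (cases "g = id") (simp_all add: linear_part_def sym_of_vec_linear(1))
qed

section \<open>Overlapping transpositions\<close>

text \<open>
  The values of the vector of \<open>(j k)\<close> at \<open>i\<close> and \<open>j\<close> are \<open>(a', b')\<close> and \<open>(a, b)\<close>, whence the difference \<open>e\<close>.
\<close>

lemma refl_form_overlap:
  assumes ijk: "distinct [i, j, k]"
    and e: "e = (a' - a, b' - b)"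
  shows "refl_form (Transposition.transpose i j)
      (u + doubled_perm_action (Transposition.transpose j k) u)
      (ref_vec a a' b b' (Transposition.transpose j k)) =
    det2 (site u i + site u i - site u j - site u k) e"
proof -
  have "is_transposition (Transposition.transpose j k)"
    using ijk by (auto simp: is_transposition_def)
  then show ?thesis
    using ijk not_sym[of j k]
    by (simp add: refl_form_transpose act_transposition site_ref_vec e det2_def algebra_simps)
qed

text \<open>
  The vector \<open>ref_vec\<close> of \<open>y\<close> takes only two values, according to whether \<open>y\<close> moves the site, and \<open>refl_form\<close> at \<open>x\<close>
  only sees its difference between the two sites that \<open>x\<close> swaps.  So equal and disjoint pairs of
  transpositions drop out.
\<close>

lemma refl_form_overlapE:
  assumes "is_transposition x" "is_transposition y"
    and "refl_form x u (ref_vec a a' b b' y) \<noteq> 0"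
  obtains i j k where "distinct [i, j, k]" "x = Transposition.transpose i j" "y = Transposition.transpose j k"
proof -
  obtain r s where rs: "r \<noteq> s" "x = Transposition.transpose r s"
    using assms(1) by (auto simp: is_transposition_def)
  obtain p q where pq: "p \<noteq> q" "y = Transposition.transpose p q"
    using assms(2) by (auto simp: is_transposition_def)
  \<comment> \<open>If \<open>y\<close> moves both \<open>r\<close> and \<open>s\<close> or neither, then its vector takes the same value at both.\<close>
  have "(y r \<noteq> r) \<noteq> (y s \<noteq> s)"
  proof
    assume "(y r \<noteq> r) = (y s \<noteq> s)"
    then have "site (ref_vec a a' b b' y) r = site (ref_vec a a' b b' y) s"
      by (simp only: site_ref_vec)
    then show False
      using assms(3) unfolding rs(2) refl_form_transpose[OF rs(1)] by (simp only: diff_self det2_simps)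
  qed
  then have moved: "(r \<in> {p, q}) \<noteq> (s \<in> {p, q})"
    unfolding pq(2) using pq(1) by (auto simp: Transposition.transpose_def split: if_splits)
  then consider "s = p" "r \<noteq> q" | "s = q" "r \<noteq> p" | "r = p" "s \<noteq> q" | "r = q" "s \<noteq> p"
    by blast
  then show ?thesis
  proof cases
    case 1 then show ?thesis using that[of r s q] rs pq by simp
  next
    case 2 then show ?thesis using that[of r s p] rs pq by (simp add: transpose_commute)
  next
    case 3 then show ?thesis using that[of s r q] rs pq by (simp add: transpose_commute)
  next
    case 4 then show ?thesis using that[of s r p] rs pq by (simp add: transpose_commute)
  qed
qed

text \<open>
  Let \<open>j = g i\<close> and \<open>k = g j\<close>.  For a 3-cycle \<open>g = (i j k)\<close>, which is \<open>(i j) (j k)\<close>, this is the scalar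
  that arises when the value of \<open>linear_part\<close> at \<open>(j k)\<close> on \<open>(v, w)\<close> is fed, together with
  \<open>u + \<^bsup>(j k)\<^esup>u\<close>, into \<open>refl_form\<close> at \<open>(i j)\<close>.
\<close>

definition overlap_term ::
    "complex \<times> complex \<Rightarrow> ('n \<Rightarrow> 'n) \<Rightarrow> 'n \<Rightarrow> 'n::finite dbl \<Rightarrow> 'n dbl \<Rightarrow> 'n dbl \<Rightarrow> complex" where
  "overlap_term e g i u v w =
     det2 (site v (g i) - site v (g (g i))) (site w (g i) - site w (g (g i))) *
     det2 (site u i + site u i - site u (g i) - site u (g (g i))) e"

text \<open>
  This is condition (iv) on a 3-cycle, and also condition (iii) at the sites outside the 3-cycle.
\<close>

lemma overlap_term_sum_zero:
  fixes g :: "'n::finite \<Rightarrow> 'n" and u v w :: "'n dbl" and e :: "complex \<times> complex"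
  defines "R \<equiv> \<lambda>i. overlap_term e g i u v w + overlap_term e g i v w u + overlap_term e g i w u v"
  assumes g: "g (g (g i)) = i"
  shows "R i + R (g i) + R (g (g i)) = 0"
proof -
  \<comment> \<open>With the differences \<open>A\<close>, \<open>B\<close> of neighbouring sites as coordinates, the sum is a combination of
    polarizations of Pluecker's relation, and expands to \<open>0\<close>.\<close>
  define A where "A u = site u i - site u (g i)" for u :: "'n dbl"
  define B where "B u = site u (g i) - site u (g (g i))" for u :: "'n dbl"
  have "overlap_term e g i u v w = - (det2 (B v) (B w) * det2 e (A u + A u + B u))"
    "overlap_term e g (g i) u v w = - (det2 (A v + B v) (A w + B w) * det2 e (B u - A u))"
    "overlap_term e g (g (g i)) u v w = det2 (A v) (A w) * det2 e (A u + B u + B u)" for u v w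
    unfolding overlap_term_def g A_def B_def using det2_skew[of _ e] det2_skew[of "site w i"]
    by (simp_all add: algebra_simps)
  then show ?thesis
    unfolding R_def by (simp del: det2_simps) (simp add: det2_def algebra_simps)
qed

text \<open>
  This is condition (iii) at the site \<open>i\<close> of the 3-cycle, whose inverse sends \<open>i\<close> to \<open>g (g i)\<close>.  Both
  sides are quadratic in \<open>e\<close>, as the constants of the 3-cycle part are.
\<close>

lemma overlap_term_cyc_form:
  fixes g :: "'n::finite \<Rightarrow> 'n" and u v w :: "'n dbl" and e :: "complex \<times> complex"
  assumes g: "distinct [i, g i, g (g i)]" "g (g (g i)) = i" "{q. g q \<noteq> q} = {i, g i, g (g i)}"
  defines "R \<equiv> overlap_term e g (g i) u v w + overlap_term e g (g i) v w u + overlap_term e g (g i) w u v"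
  defines "D \<equiv> \<lambda>u. site u (g (g i)) - site u i"
  shows "fst e * R = 2 * (cyc_form e g v w * fst (D u) + cyc_form e g w u * fst (D v) + cyc_form e g u v * fst (D w))"
    and "snd e * R = 2 * (cyc_form e g v w * snd (D u) + cyc_form e g w u * snd (D v) + cyc_form e g u v * snd (D w))"
proof -
  \<comment> \<open>\<open>D\<close> and \<open>E\<close> span the differences of the three sites, and both sides are short in terms of them:
    \<open>overlap_term\<close> at \<open>g i\<close> is a product in two \<open>D\<close>'s and one \<open>E\<close>, and \<open>cyc_form\<close> is half the wedge product
    of \<open>E\<close> and \<open>D\<close> under \<open>det2 e\<close>.\<close>
  define E where "E u = site u (g i) + site u (g i) - site u (g (g i)) - site u i" for u :: "'n dbl"
  have "overlap_term e g (g i) u v w = - (det2 (D v) (D w) * det2 e (E u))" for u v w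
    unfolding overlap_term_def g(2) D_def E_def using det2_skew[of _ e] by (simp add: algebra_simps)
  moreover have "2 * cyc_form e g u v = det2 e (E u) * det2 e (D v) - det2 e (D u) * det2 e (E v)" for u v
    unfolding cyc_form_three_cycle[OF g] D_def E_def by (simp add: algebra_simps)
  ultimately show "fst e * R = 2 * (cyc_form e g v w * fst (D u) + cyc_form e g w u * fst (D v) + cyc_form e g u v * fst (D w))"
    and "snd e * R = 2 * (cyc_form e g v w * snd (D u) + cyc_form e g w u * snd (D v) + cyc_form e g u v * snd (D w))"
    using plucker_wedge[where e=e and ?c1.0="D u" and ?c2.0="D v" and ?c3.0="D w" and ?d1.0="E u" and ?d2.0="E v" and ?d3.0="E w"]
    unfolding R_def by (simp_all only: distrib_left mult.assoc[symmetric]) (simp_all add: algebra_simps)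
qed

section \<open>Sums over factorizations\<close>

text \<open>
  The contribution of one factorization \<open>x y\<close>.  For \<open>y = 1\<close> the inner value is a multiple of \<open>t\<close>, which
  is constant along the sites and is killed by every component except the one at \<open>x = 1\<close>, where
  Pluecker's relation applies.  For a transposition \<open>y\<close> it is a multiple of \<open>U y\<close>, which is killed by
  the component at \<open>1\<close>, having sum \<open>0\<close>, and by those at 3-cycles, \<open>det2 e\<close> being constant on it.
\<close>

lemma composition_cyclic_sum:
  fixes x y :: "'n::finite \<Rightarrow> 'n" and t v1 v2 v3 :: "'n dbl" and p q r :: complex
  assumes x: "bij x"
    and t: "\<And>i. site t i = t0"
    and U: "\<And>g. is_transposition g \<Longrightarrow> site_sum (U g) = 0"
      "\<And>g i. is_transposition g \<Longrightarrow> det2 e (site (U g) i) = s"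
  defines "F \<equiv> \<lambda>v1 v2 v3. orbifold_form e p q r x (v1 + doubled_perm_action y v1) (linear_part t U y v2 v3)"
  defines "H \<equiv> \<lambda>v1 v2 v3. refl_form y v2 v3 * refl_form x (v1 + doubled_perm_action y v1) (U y)"
  shows "F v1 v2 v3 + F v2 v3 v1 + F v3 v1 v2 =
    (if is_transposition x \<and> is_transposition y then q * (H v1 v2 v3 + H v2 v3 v1 + H v3 v1 v2) else 0)"
proof -
  consider "y = id" | "is_transposition y" | "y \<noteq> id" "\<not> is_transposition y"
    by blast
  then show ?thesis
  proof cases
    case 1
    \<comment> \<open>The value of \<open>linear_part\<close> is a multiple of \<open>t\<close>, which only the identity component pairs nontrivially.\<close>
    have id: "doubled_perm_action id v = v" for v :: "'n dbl"
      by (simp add: dbl_eq_iff site_action)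
    have "refl_form x u t = 0" "cyc_form e x u t = 0" for u
      using refl_form_const[OF t] cyc_form_const[OF x, of e t] t by simp_all
    then have "orbifold_form e p q r x u t = (if x = id then p * det2 (site_sum u) (site_sum t) else 0)"
      for u
      by (simp add: orbifold_form_def cong: if_cong)
    moreover have "linear_part t U y v2 v3 = det2 (site_sum v2) (site_sum v3) *s t" for v2 v3
      using transposition_not_id[of y] 1 by (auto simp: linear_part_def)
    moreover have "F v1 v2 v3 = orbifold_form e p q r x v1 (linear_part t U y v2 v3) +
        orbifold_form e p q r x v1 (linear_part t U y v2 v3)" for v1 v2 v3
      unfolding F_def 1 id orbifold_form_add_left ..
    ultimately have "F v1 v2 v3 =
        (if x = id then 2 * p * (det2 (site_sum v2) (site_sum v3) * det2 (site_sum v1) (site_sum t)) else 0)"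
      for v1 v2 v3
      by (simp add: orbifold_form_scale_right)
    then show ?thesis
      using plucker(3)[of "site_sum v2" "site_sum v3" "site_sum v1" "site_sum t"]
        transposition_not_id[of y] 1
      by (auto simp: distrib_left[symmetric])
  next
    case 2
    then have "F v1 v2 v3 = (if is_transposition x then q * H v1 v2 v3 else 0)" for v1 v2 v3
      unfolding F_def H_def linear_part_def using transposition_not_id[of y] U cyc_form_const[OF x, of e "U y" s]
      by (simp add: orbifold_form_scale_right) (simp add: orbifold_form_def)
    then show ?thesis
      using 2 by (simp add: distrib_left)
  next
    case 3
    then show ?thesis
      using orbifold_form_scale_right[of e p q r x _ 0 0] by (simp add: F_def linear_part_def)
  qed
qed

text \<open>
  Only factorizations of a 3-cycle into two transpositions contribute, and these are
  \<open>(i j) (j k)\<close>, \<open>(j k) (k i)\<close> and \<open>(k i) (i j)\<close>.  The weight \<open>q x\<close> is left free: it is the constant \<open>c\<close> in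
  condition (iv) and a coordinate of \<open>U x\<close> in condition (iii).
\<close>

lemma composition_sum:
  fixes g :: "'n::finite \<Rightarrow> 'n" and t v1 v2 v3 :: "'n dbl" and q :: "('n \<Rightarrow> 'n) \<Rightarrow> complex" and p r :: complex
  assumes t: "\<And>i. site t i = t0"
    and a: "2 * a + (of_nat CARD('n) - 2) * a' = 0" and b: "2 * b + (of_nat CARD('n) - 2) * b' = 0"
  defines "e \<equiv> (a' - a, b' - b)"
  defines "F \<equiv> \<lambda>x y v1 v2 v3. orbifold_form e p (q x) r x (v1 + doubled_perm_action y v1)
    (linear_part t (ref_vec a a' b b') y v2 v3)"
  shows "(\<Sum>(x, y)\<in>{(x, y). bij x \<and> bij y \<and> x \<circ> y = g}. F x y v1 v2 v3 + F x y v2 v3 v1 + F x y v3 v1 v2) =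
    (if is_three_cycle g then \<Sum>i | g i \<noteq> i. q (Transposition.transpose i (g i)) *
       (overlap_term e g i v1 v2 v3 + overlap_term e g i v2 v3 v1 + overlap_term e g i v3 v1 v2) else 0)"
    (is "sum ?F ?P = _")
proof -
  let ?U = "ref_vec a a' b b'"
  define H where "H x y v1 v2 v3 = refl_form y v2 v3 * refl_form x (v1 + doubled_perm_action y v1) (?U y)"
    for x y and v1 v2 v3 :: "'n dbl"
  \<comment> \<open>All sites of \<open>U y\<close> lie on a line parallel to \<open>e\<close>, being \<open>(a, b)\<close> or \<open>(a', b') = (a, b) + e\<close>.\<close>
  have e_const: "det2 e (site (?U y) i) = det2 (a', b') (a, b)" for y :: "'n \<Rightarrow> 'n" and i
    by (simp add: site_ref_vec e_def det2_def algebra_simps)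
  have F: "F x y v1 v2 v3 + F x y v2 v3 v1 + F x y v3 v1 v2 =
      (if is_transposition x \<and> is_transposition y then q x * (H x y v1 v2 v3 + H x y v2 v3 v1 + H x y v3 v1 v2) else 0)"
    if "bij x" for x y
    unfolding F_def H_def
    by (rule composition_cyclic_sum[OF that t site_sum_ref_vec[OF _ a b] e_const])
  have H: "H (Transposition.transpose i j) (Transposition.transpose j k) v1 v2 v3 = overlap_term e g i v1 v2 v3"
    if "distinct [i, j, k]" "j = g i" "k = g (g i)" for i j k v1 v2 v3
  proof -
    have "j \<noteq> k"
      using that(1) by simp
    then show ?thesis
      unfolding H_def refl_form_overlap[OF that(1) e_def[THEN meta_eq_to_obj_eq]] refl_form_transpose[OF \<open>j \<noteq> k\<close>]
      by (simp only: overlap_term_def that(2,3))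
  qed
  \<comment> \<open>Off the pairs \<open>((i j), (j k))\<close> with \<open>g = (i j k)\<close> there is nothing left, and so
    nothing at all unless \<open>g\<close> is a 3-cycle.\<close>
  have zero: "\<exists>i. distinct [i, g i, g (g i)] \<and> is_three_cycle g \<and>
      x = Transposition.transpose i (g i) \<and> y = Transposition.transpose (g i) (g (g i))"
    if xy: "(x, y) \<in> ?P" "?F (x, y) \<noteq> 0" for x y
  proof -
    have "is_transposition x" "is_transposition y" "\<exists>u. refl_form x u (?U y) \<noteq> 0"
      using xy F[of x y] by (simp_all add: H_def split: if_splits) (metis add.right_neutral mult_zero_right)+
    then obtain i j k where ijk: "distinct [i, j, k]" "x = Transposition.transpose i j" "y = Transposition.transpose j k"
      using refl_form_overlapE by metis
    moreover have g: "g = cycle_of_list [i, j, k]"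
      using xy(1) unfolding ijk(2,3) by auto
    moreover have "g i = j" "g j = k"
      using ijk(1) unfolding g by (auto simp: Transposition.transpose_def)
    ultimately show ?thesis
      unfolding is_three_cycle_def by metis
  qed
  show ?thesis
  proof (cases "is_three_cycle g")
    case False
    then have "sum ?F ?P = 0"
      using zero by (intro sum.neutral) blast
    then show ?thesis
      using False by simp
  next
    case True
    \<comment> \<open>The factorizations of a 3-cycle into two transpositions, one for each moved point.\<close>
    let ?f = "\<lambda>i. (Transposition.transpose i (g i), Transposition.transpose (g i) (g (g i)))"
    have comp: "Transposition.transpose i (g i) \<circ> Transposition.transpose (g i) (g (g i)) = g" if "g i \<noteq> i" for i
    proof
      fix m
      define j where "j = g i"
      define k where "k = g j"
      have ijk: "i \<noteq> j" "j \<noteq> k" "i \<noteq> k" "g i = j" "g j = k" "g k = i"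
        using three_cycle_at_moved_point(1,2)[OF True that] unfolding j_def k_def by auto
      have "{q. g q \<noteq> q} = {i, j, k}"
        using three_cycle_at_moved_point(3)[OF True that] unfolding j_def k_def .
      then consider "m = i" | "m = j" | "m = k" | "g m = m" "m \<noteq> i" "m \<noteq> j" "m \<noteq> k"
        by blast
      then show "(Transposition.transpose i (g i) \<circ> Transposition.transpose (g i) (g (g i))) m = g m"
        unfolding ijk(4,5) using ijk(1-3,6) by cases (simp_all add: ijk(4,5))
    qed
    have inj: "inj_on ?f {i. g i \<noteq> i}"
    proof (rule inj_onI)
      fix i j
      assume "i \<in> {i. g i \<noteq> i}" "j \<in> {i. g i \<noteq> i}" and f: "?f i = ?f j"
      then have "g i \<noteq> i" "g j \<noteq> j" by simp_all
      define p where "p = g i"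
      define q where "q = g p"
      have "distinct [i, p, q]"
        using three_cycle_at_moved_point(1)[OF True \<open>g i \<noteq> i\<close>] unfolding p_def q_def .
      moreover have "{i, p} = {j, g j}" "{p, q} = {g j, g (g j)}"
        using f three_cycle_at_moved_point(1)[OF True \<open>g i \<noteq> i\<close>] three_cycle_at_moved_point(1)[OF True \<open>g j \<noteq> j\<close>]
          moved_transpose[of i p] moved_transpose[of j "g j"] moved_transpose[of p q] moved_transpose[of "g j" "g (g j)"]
        unfolding p_def q_def by (metis Pair_inject distinct_length_2_or_more)+
      ultimately show "i = j"
        by (auto simp: doubleton_eq_iff)
    qed
    have "sum ?F ?P = sum ?F (?f ` {i. g i \<noteq> i})"
    proof (rule sum.mono_neutral_right)
      show "?f ` {i. g i \<noteq> i} \<subseteq> ?P"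
        using comp by auto
      show "\<forall>xy\<in>?P - ?f ` {i. g i \<noteq> i}. ?F xy = 0"
        using zero by fastforce
    qed simp
    also have "\<dots> = (\<Sum>i | g i \<noteq> i. ?F (?f i))"
      by (simp add: sum.reindex[OF inj])
    also have "\<dots> = (\<Sum>i | g i \<noteq> i. q (Transposition.transpose i (g i)) *
       (overlap_term e g i v1 v2 v3 + overlap_term e g i v2 v3 v1 + overlap_term e g i v3 v1 v2))"
    proof (rule sum.cong)
      fix i
      assume "i \<in> {i. g i \<noteq> i}"
      then have d: "distinct [i, g i, g (g i)]"
        using three_cycle_at_moved_point(1)[OF True] by blast
      then have "is_transposition (Transposition.transpose i (g i))" "is_transposition (Transposition.transpose (g i) (g (g i)))"
        unfolding is_transposition_def by auto
      then show "?F (?f i) = q (Transposition.transpose i (g i)) *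
         (overlap_term e g i v1 v2 v3 + overlap_term e g i v2 v3 v1 + overlap_term e g i v3 v1 v2)"
        using F[of "Transposition.transpose i (g i)" "Transposition.transpose (g i) (g (g i))"] H[OF d refl refl]
        by simp
    qed simp
    finally show ?thesis
      using True by simp
  qed
qed

text \<open>
  Condition (iv).  The outer component has the same constant \<open>c\<close> at all transpositions, so the three
  coefficients on a 3-cycle are simply added.
\<close>

lemma constant_part_composition_sum:
  fixes g :: "'n::finite \<Rightarrow> 'n" and t u v w :: "'n dbl" and a a' b b' c \<beta> :: complex
  assumes t: "\<And>i. site t i = t0"
    and a: "2 * a + (of_nat CARD('n) - 2) * a' = 0" and b: "2 * b + (of_nat CARD('n) - 2) * b' = 0"
  defines "U \<equiv> ref_vec a a' b b'" and "e \<equiv> (a' - a, b' - b)"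
  shows "(\<Sum>(x, y)\<in>{(x, y). bij x \<and> bij y \<and> x \<circ> y = g}. orbifold_form e \<beta> c 1 x (u + doubled_perm_action y u) (linear_part t U y v w)) +
      (\<Sum>(x, y)\<in>{(x, y). bij x \<and> bij y \<and> x \<circ> y = g}. orbifold_form e \<beta> c 1 x (v + doubled_perm_action y v) (linear_part t U y w u)) +
      (\<Sum>(x, y)\<in>{(x, y). bij x \<and> bij y \<and> x \<circ> y = g}. orbifold_form e \<beta> c 1 x (w + doubled_perm_action y w) (linear_part t U y u v)) = 0"
proof -
  let ?R = "\<lambda>g i u v w. overlap_term e g i u v w + overlap_term e g i v w u + overlap_term e g i w u v"
  note compositions = composition_sum[OF t a b, folded e_def U_def]
  have "(\<Sum>i | g i \<noteq> i. c * ?R g i u v w) = 0" if "is_three_cycle g"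
    using that
  proof (rule three_cycleE)
    fix i
    assume "distinct [i, g i, g (g i)]" "g (g (g i)) = i" "{q. g q \<noteq> q} = {i, g i, g (g i)}"
    then show ?thesis
      using overlap_term_sum_zero[of g i e u v w] by (simp add: distrib_left[symmetric] add.assoc)
  qed
  then show ?thesis
    using compositions[of \<beta> "\<lambda>x. c" 1 u v w g]
    by (simp add: sum.distrib[symmetric] case_prod_unfold)
qed

text \<open>
  Condition (iii).  Both sides vanish unless \<open>g\<close> is a 3-cycle.
\<close>

lemma linear_part_composition_sum:
  fixes g :: "'n::finite \<Rightarrow> 'n" and t u v w :: "'n dbl" and a a' b b' c \<beta> :: complex
  assumes g: "bij g" and t: "\<And>i. site t i = t0"
    and a: "2 * a + (of_nat CARD('n) - 2) * a' = 0" and b: "2 * b + (of_nat CARD('n) - 2) * b' = 0"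
  defines "U \<equiv> ref_vec a a' b b'" and "e \<equiv> (a' - a, b' - b)"
  shows "(\<Sum>(x, y)\<in>{(x, y). bij x \<and> bij y \<and> x \<circ> y = g}. linear_part t U x (u + doubled_perm_action y u) (linear_part t U y v w)) +
      (\<Sum>(x, y)\<in>{(x, y). bij x \<and> bij y \<and> x \<circ> y = g}. linear_part t U x (v + doubled_perm_action y v) (linear_part t U y w u)) +
      (\<Sum>(x, y)\<in>{(x, y). bij x \<and> bij y \<and> x \<circ> y = g}. linear_part t U x (w + doubled_perm_action y w) (linear_part t U y u v)) =
      2 *s (orbifold_form e \<beta> c 1 g v w *s (doubled_perm_action g u - u) +
        orbifold_form e \<beta> c 1 g w u *s (doubled_perm_action g v - v) +
        orbifold_form e \<beta> c 1 g u v *s (doubled_perm_action g w - w))" (is "?lhs = 2 *s ?rhs")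
proof -
  let ?R = "\<lambda>g i u v w. overlap_term e g i u v w + overlap_term e g i v w u + overlap_term e g i w u v"
  note compositions = composition_sum[OF t a b, folded e_def U_def]
  define L where "L = ?lhs"
  have lhs: "L $ k =
      (if is_three_cycle g then \<Sum>i | g i \<noteq> i. U (Transposition.transpose i (g i)) $ k * ?R g i u v w else 0)" for k
    using compositions[of "t $ k" "\<lambda>x. U x $ k" 0 u v w g]
    by (simp add: L_def sum.distrib[symmetric] case_prod_unfold linear_part_nth[where e = e, symmetric])
  have "L = 2 *s ?rhs"
  proof (cases "is_three_cycle g")
    case False
    have "?rhs = 0"
    proof (cases "is_transposition g")
      case True
      then have "orbifold_form e \<beta> c 1 g u v = c * refl_form g u v" for u v
        using False transposition_not_id[OF True] by (simp add: orbifold_form_def)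
      then have "?rhs = c *s (refl_form g v w *s (doubled_perm_action g u - u) +
          refl_form g w u *s (doubled_perm_action g v - v) + refl_form g u v *s (doubled_perm_action g w - w))"
        by (simp add: vec.scale_right_distrib)
      then show ?thesis
        by (simp only: refl_form_cyclic_sum[OF True]) simp
    next
      case not_transposition: False
      have "doubled_perm_action id u = u" for u :: "'n dbl"
        by (simp add: dbl_eq_iff site_action)
      then show ?thesis
        using False not_transposition by (cases "g = id") (simp_all add: orbifold_form_def)
    qed
    moreover have "L $ k = 0" for k
      unfolding lhs using False by (rule if_not_P)
    then have "L = 0"
      unfolding vec_eq_iff zero_index by blast
    ultimately show ?thesis
      by (simp only: vec.scale_zero_right)
  next
    case True
    \<comment> \<open>Fix a site \<open>m\<close>.  If \<open>g\<close> fixes \<open>m\<close>, all three vectors \<open>U x\<close> equal \<open>(a', b')\<close> there and the three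
      coefficients add up to \<open>0\<close>.  If \<open>g\<close> moves \<open>m\<close>, two of them equal \<open>(a, b)\<close> and one equals \<open>(a', b')\<close>,
      so that a multiple of \<open>e\<close> survives: the one that the 3-cycle part accounts for.\<close>
    obtain i0 where i0: "distinct [i0, g i0, g (g i0)]" "g (g (g i0)) = i0" "{q. g q \<noteq> q} = {i0, g i0, g (g i0)}"
      using True by (rule three_cycleE)
    have form: "orbifold_form e \<beta> c 1 g u v = cyc_form e g u v" for u v
      using True three_cycle_not_transposition[OF True] by (simp add: orbifold_form_def)
    have inv: "inv_into UNIV g m = g (g m)" for m
      using g three_cycle_cube[OF True, of m] by (metis bij_inv_eq_iff)
    have D: "site (doubled_perm_action g u - u) m = site u (g (g m)) - site u m" for u m
      by (simp add: site_action[OF g] inv)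
    have rhs: "site (2 *s ?rhs) m =
        (2 * (cyc_form e g v w * fst (site u (g (g m)) - site u m) + cyc_form e g w u * fst (site v (g (g m)) - site v m) +
           cyc_form e g u v * fst (site w (g (g m)) - site w m)),
         2 * (cyc_form e g v w * snd (site u (g (g m)) - site u m) + cyc_form e g w u * snd (site v (g (g m)) - site v m) +
           cyc_form e g u v * snd (site w (g (g m)) - site w m)))" for m
      unfolding site_simps(1,3) D form by (simp only: fst_conv snd_conv fst_add snd_add)
    have U_site: "site (U (Transposition.transpose i (g i))) m = (if m = i \<or> m = g i then (a, b) else (a', b'))"
      if "g i \<noteq> i" for i m
      using that by (auto simp: U_def site_ref_vec Transposition.transpose_def)
    have "site L m = site (2 *s ?rhs) m" for m
    proof (cases "g m = m")
      case fixed: True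
      then have "site (U (Transposition.transpose i (g i))) m = (a', b')" if "g i \<noteq> i" for i
        using U_site[OF that] fixed that three_cycle_at_moved_point(1)[OF True that] by auto
      then have nth: "U (Transposition.transpose i (g i)) $ Inl m = a'"
        "U (Transposition.transpose i (g i)) $ Inr m = b'" if "g i \<noteq> i" for i
        using that by (simp_all add: site_def)
      have "(\<Sum>i | g i \<noteq> i. s * ?R g i u v w) = 0" for s
        unfolding i0(3) using i0(1) overlap_term_sum_zero[of g i0 e u v w, OF i0(2)]
        by (simp add: distrib_left[symmetric] add.assoc)
      then have "site L m = 0"
        using True unfolding site_def lhs by (simp add: nth zero_prod_def)
      then show ?thesis
        unfolding rhs by (simp add: fixed zero_prod_def)
    next
      case False
      note cyc = three_cycle_at_moved_point[OF True False]
      define \<rho> where "\<rho> i = ?R g i u v w" for i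
      have \<rho>: "\<rho> (g (g m)) = - (\<rho> m + \<rho> (g m))"
        using overlap_term_sum_zero[of g m e u v w, OF cyc(2)] unfolding \<rho>_def by (metis add_eq_0_iff)
      have U_m: "site (U (Transposition.transpose m (g m))) m = (a, b)"
        "site (U (Transposition.transpose (g m) (g (g m)))) m = (a', b')"
        "site (U (Transposition.transpose (g (g m)) (g (g (g m))))) m = (a, b)"
        using U_site[of m m] U_site[of "g m" m] U_site[of "g (g m)" m] cyc(1,2) by auto
      have "site L m = (fst e * \<rho> (g m), snd e * \<rho> (g m))"
        using True cyc(1) U_m unfolding site_def lhs cyc(3) \<rho>_def[symmetric]
        by (simp add: e_def cyc(2) \<rho> algebra_simps)
      then show ?thesis
        using overlap_term_cyc_form[OF cyc, of e u v w]
        unfolding rhs \<rho>_def by (simp only:)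
    qed
    then show ?thesis
      unfolding dbl_eq_iff by blast
  qed
  then show ?thesis
    unfolding L_def .
qed

section \<open>The Drinfeld orbifold algebra maps\<close>

text \<open>
  Sums over \<open>Alt\<^sub>3\<close> are cyclic sums.
\<close>

lemma sum_alt_group_3:
  "(\<Sum>\<sigma>\<in>carrier (alt_group 3). f (\<sigma> 1) (\<sigma> 2) (\<sigma> 3)) = f 1 2 3 + f 2 3 1 + f 3 1 2"
  for f :: "nat \<Rightarrow> nat \<Rightarrow> nat \<Rightarrow> 'b::comm_monoid_add"
proof -
  define c :: "nat \<Rightarrow> nat" where "c = cycle_of_list [1, 2, 3]"
  define d :: "nat \<Rightarrow> nat" where "d = cycle_of_list [1, 3, 2]"
  have c: "c 1 = 2" "c 2 = 3" "c 3 = 1" and d: "d 1 = 3" "d 2 = 1" "d 3 = 2"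
    by (simp_all add: c_def d_def Transposition.transpose_def)
  have "{id, c, d} \<subseteq> carrier (alt_group 3)"
  proof -
    have "cycle_of_list [i, j, k] \<in> carrier (alt_group 3)" if "distinct [i, j, k]" "{i, j, k} \<subseteq> {1..3}" for i j k :: nat
      using that three_cycles_incl[of 3] by fastforce
    from this[of 1 2 3] this[of 1 3 2] show ?thesis
      by (simp add: c_def d_def alt_group_carrier evenperm_id permutes_id)
  qed
  \<comment> \<open>Three elements exhaust the group, which has order \<open>3! / 2\<close>.\<close>
  moreover have ne: "c \<noteq> id" "d \<noteq> id" "c \<noteq> d"
    using c d by (metis id_apply numeral_eq_one_iff semiring_norm(84) semiring_norm(85) numeral_eq_iff semiring_norm(89))+
  moreover have "2 * card (carrier (alt_group 3)) = fact 3"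
    by (rule alt_group_card_carrier) simp
  then have "card (carrier (alt_group 3)) = 3"
    by (simp add: fact_numeral)
  moreover from this have "finite (carrier (alt_group 3))"
    by (metis card.infinite zero_neq_numeral)
  ultimately have "carrier (alt_group 3) = {id, c, d}"
    by (intro card_subset_eq[symmetric]) auto
  then show ?thesis
    using ne c d by (simp add: add_ac)
qed

theorem theorem5p10:
  fixes aa bb :: "nat \<Rightarrow> complex"
    and \<alpha> \<beta> a a' b b' c :: complex
  assumes n: "CARD('n::finite) \<ge> 3"
    and zero: "\<forall>i\<in>{1, 2, 3, 5, 6}. aa i = 0 \<and> bb i = 0"
    and eq47: "aa 4 = aa 7" "bb 4 = bb 7"
    and nonzero47: "\<not> (aa 4 = 0 \<and> bb 4 = 0)"
    and \<alpha>\<beta>: "\<alpha> = \<beta>"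
    and a: "2 * a + (of_nat CARD('n) - 2) * a' = 0"
    and b: "2 * b + (of_nat CARD('n) - 2) * b' = 0"
    and nonzero: "\<not> (a = 0 \<and> a' = 0 \<and> b = 0 \<and> b' = 0)"
  shows "drinfeld_orbifold_algebra_map (BijGroup (UNIV :: 'n set)) doubled_perm_action
           (\<lambda>g u v. \<kappa>L_one aa bb g u v + \<kappa>L_ref a a' b b' g u v)
           (\<lambda>g u v. \<kappa>C_one \<alpha> \<beta> g u v + \<kappa>C_ref c g u v + \<kappa>C_3cyc a a' b b' g u v)"
proof -
  define t :: "'n dbl" where "t = aa 7 *s (\<Sum>k\<in>UNIV. xvec k) + bb 7 *s (\<Sum>k\<in>UNIV. yvec k)"
  define U :: "('n \<Rightarrow> 'n) \<Rightarrow> 'n dbl" where "U = ref_vec a a' b b'"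
  define e where "e = (a' - a, b' - b)"
  have linear: "(\<lambda>g u v. \<kappa>L_one aa bb g u v + \<kappa>L_ref a a' b b' g u v) = linear_part t U"
    by (simp add: fun_eq_iff linear_part_def \<kappa>L_one_eq[OF zero eq47] \<kappa>L_ref_eq t_def U_def)
  have const: "(\<lambda>g u v. \<kappa>C_one \<alpha> \<beta> g u v + \<kappa>C_ref c g u v + \<kappa>C_3cyc a a' b b' g u v) = orbifold_form e \<beta> c 1"
    by (simp add: fun_eq_iff orbifold_form_def \<alpha>\<beta> \<kappa>C_one_eq \<kappa>C_ref_eq \<kappa>C_3cyc_eq e_def cong: if_cong)
  have t: "site t i = (aa 7, bb 7)" for i
    by (simp add: site_def t_def)
  have act_t: "doubled_perm_action h t = t" if "bij h" for h
    by (simp add: dbl_eq_iff site_action[OF that] t)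
  have act_U: "doubled_perm_action h (U g) = U (h \<circ> g \<circ> inv_into UNIV h)" if "bij h" for g h
    unfolding U_def by (rule ref_vec_equivariant[OF that])
  have fixed: "doubled_perm_action g (linear_part t U g u v) = linear_part t U g u v" if "bij g" for g u v
  proof -
    have "g \<circ> g \<circ> inv_into UNIV g = g"
      using that by (simp add: fun_eq_iff bij_is_surj surj_f_inv_f)
    then show ?thesis
      using that by (simp only: linear_part_def doubled_perm_action_linear act_t act_U)
  qed
  have pairs: "{(x, y). x \<in> carrier (BijGroup UNIV) \<and> y \<in> carrier (BijGroup UNIV) \<and> x \<otimes>\<^bsub>BijGroup UNIV\<^esub> y = g} =
      {(x, y). bij x \<and> bij y \<and> x \<circ> y = g}" for g :: "'n \<Rightarrow> 'n"
    by auto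
  let ?P = "\<lambda>g :: 'n \<Rightarrow> 'n. {(x, y). bij x \<and> bij y \<and> x \<circ> y = g}"
  note compositions = linear_part_composition_sum[OF _ t a b, folded e_def U_def]
    constant_part_composition_sum[OF t a b, folded e_def U_def]
  show ?thesis
    unfolding drinfeld_orbifold_algebra_map_def linear const pairs
  proof (intro conjI ballI allI)
    show "linear_group_action (BijGroup (UNIV :: 'n set)) doubled_perm_action"
      by (rule doubled_perm_action_linear_group_action)
  next
    fix g :: "'n \<Rightarrow> 'n"
    show "skew_bilinear vector_scalar_mult (linear_part t U g)"
      by (rule linear_part_skew_bilinear)
    show "skew_bilinear times (orbifold_form e \<beta> c 1 g)"
      by (rule orbifold_form_skew_bilinear)
  next
    fix g :: "'n \<Rightarrow> 'n" and u v
    assume "g \<in> carrier (BijGroup UNIV)"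
    then show "doubled_perm_action g (linear_part t U g u v) = linear_part t U g u v"
      by (simp add: fixed)
  next
    fix g h :: "'n \<Rightarrow> 'n" and u v
    assume "g \<in> carrier (BijGroup UNIV)" "h \<in> carrier (BijGroup UNIV)"
    then have h: "bij h" and conj: "h \<otimes>\<^bsub>BijGroup UNIV\<^esub> g \<otimes>\<^bsub>BijGroup UNIV\<^esub> inv\<^bsub>BijGroup UNIV\<^esub> h = h \<circ> g \<circ> inv_into UNIV h"
      by (simp_all add: bij_comp bij_imp_bij_inv)
    show "doubled_perm_action h (linear_part t U g u v) =
        linear_part t U (h \<otimes>\<^bsub>BijGroup UNIV\<^esub> g \<otimes>\<^bsub>BijGroup UNIV\<^esub> inv\<^bsub>BijGroup UNIV\<^esub> h)
          (doubled_perm_action h u) (doubled_perm_action h v)"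
      unfolding conj by (intro linear_part_equivariant h act_t act_U)
    show "orbifold_form e \<beta> c 1 g u v =
        orbifold_form e \<beta> c 1 (h \<otimes>\<^bsub>BijGroup UNIV\<^esub> g \<otimes>\<^bsub>BijGroup UNIV\<^esub> inv\<^bsub>BijGroup UNIV\<^esub> h)
          (doubled_perm_action h u) (doubled_perm_action h v)"
      unfolding conj by (rule orbifold_form_conj[OF h, symmetric])
  next
    fix g :: "'n \<Rightarrow> 'n" and v :: "nat \<Rightarrow> 'n dbl"
    assume "g \<in> carrier (BijGroup UNIV)"
    then have g: "bij g" by simp
    show "(\<Sum>\<sigma>\<in>carrier (alt_group 3). sym_of_vec (linear_part t U g (v (\<sigma> 2)) (v (\<sigma> 3))) *
        sym_of_vec (doubled_perm_action g (v (\<sigma> 1)) - v (\<sigma> 1))) = 0"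
      using linear_part_cyclic_sum_zero[OF g]
      by (subst sum_alt_group_3[of "\<lambda>i j k. sym_of_vec (linear_part t U g (v j) (v k)) *
        sym_of_vec (doubled_perm_action g (v i) - v i)"])
    show "(\<Sum>\<sigma>\<in>carrier (alt_group 3). \<Sum>(x, y)\<in>?P g.
          linear_part t U x (v (\<sigma> 1) + doubled_perm_action y (v (\<sigma> 1))) (linear_part t U y (v (\<sigma> 2)) (v (\<sigma> 3)))) =
        2 *s (\<Sum>\<sigma>\<in>carrier (alt_group 3).
          orbifold_form e \<beta> c 1 g (v (\<sigma> 2)) (v (\<sigma> 3)) *s (doubled_perm_action g (v (\<sigma> 1)) - v (\<sigma> 1)))"
      unfolding sum_alt_group_3[of "\<lambda>i j k. \<Sum>(x, y)\<in>?P g.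
          linear_part t U x (v i + doubled_perm_action y (v i)) (linear_part t U y (v j) (v k))"]
        sum_alt_group_3[of "\<lambda>i j k. orbifold_form e \<beta> c 1 g (v j) (v k) *s (doubled_perm_action g (v i) - v i)"]
      by (rule compositions(1)[OF g])
    show "(\<Sum>\<sigma>\<in>carrier (alt_group 3). \<Sum>(x, y)\<in>?P g.
          orbifold_form e \<beta> c 1 x (v (\<sigma> 1) + doubled_perm_action y (v (\<sigma> 1)))
            (linear_part t U y (v (\<sigma> 2)) (v (\<sigma> 3)))) = 0"
      unfolding sum_alt_group_3[of "\<lambda>i j k. \<Sum>(x, y)\<in>?P g.
          orbifold_form e \<beta> c 1 x (v i + doubled_perm_action y (v i)) (linear_part t U y (v j) (v k))"]
      by (rule compositions(2))
  qed
qed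

end
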